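(* The 6th order symmetric tensor $\Upsilon_{IJKLMN}$ on $\mathbb R^8$ defined by $$\Upsilon_{IJKLMN}x^Ix^Jx^Kx^Lx^Mx^N=F(\vec X)=\Phi(\vec X)+g(\vec X,\vec X)^3$$ (with $\Phi$ and $g$ as in the context) reduces $\mathbf{GL}(8,\mathbb R)$, via $\mathbf{SO}(8)$, to the irreducible $\mathbf{SU}(2)\times\mathbf{SU}(2)$ associated with the representation $\rho$. That is, the stabilizer of $\Upsilon_{IJKLMN}$ under the action of $\mathbf{GL}(8,\mathbb R)$ is contained in $\mathbf{SO}(8)$ and equals the image $\rho(\mathbf{SU}(2)\times\mathbf{SU}(2))$ of the irreducible 8-dimensional representation $\rho$.
   Context: For $\vec X=(x^1,\dots,x^8)\in\mathbb R^8$ let $\iota(\vec X)$ be the antisymmetric $7\times7$ matrix $$\iota(\vec X)=\begin{pmatrix}\mathbf 0_{3\times3}&\alpha\\-\alpha^t&\mathbf 0_{4\times4}\end{pmatrix},\quad \alpha=\begin{pmatrix}-x^3+\sqrt3x^4&-x^5+\sqrt3x^6&-x^7+\sqrt3x^8&-2x^1\\-x^1-\sqrt3x^2&x^7+\sqrt3x^8&-x^5-\sqrt3x^6&2x^3\\-2x^7&x^1-\sqrt3x^2&-x^3-\sqrt3x^4&-2x^5\end{pmatrix},$$ and let $\mathbb M^8=\iota(\mathbb R^8)$; $\iota:\mathbb R^8\to\mathbb M^8$ is a linear isomorphism. The characteristic polynomial is $$\det(\iota(\vec X)-\lambda I)=-\lambda^7-6g(\vec X,\vec X)\lambda^5-9g(\vec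 X,\vec X)^2\lambda^3+2\Phi(\vec X)\lambda,$$ where $g(\vec X,\vec X)=\sum_{I=1}^8(x^I)^2$, and this defines the homogeneous polynomial $\Phi$ of degree 6. Representation $\rho$. Let $E_{ab}$ be the $7\times7$ matrix with a $1$ in position $(a,b)$ and zeros elsewhere, and $L_{ab}=E_{ab}-E_{ba}$. Put $s_1=\tfrac12(L_{45}-L_{67})$, $s_2=\tfrac12(L_{46}+L_{57})$, $s_3=\tfrac12(L_{47}-L_{56})$, $\sigma_1=-L_{12}-\tfrac12(L_{47}+L_{56})$, $\sigma_2=L_{13}+\tfrac12(L_{46}-L_{57})$, $\sigma_3=L_{23}-\tfrac12(L_{45}+L_{67})$. These satisfy $[s_j,s_k]=\epsilon_{ijk}s_i$, $[\sigma_j,\sigma_k]=\epsilon_{ijk}\sigma_i$, $[s_i,\sigma_j]=0$, and the products $h=e^{t_1s_1}e^{t_2s_2}e^{t_3s_3}e^{\tau_1\sigma_1}e^{\tau_2\sigma_2}e^{\tau_3\sigma_3}$ ($t_i,\tau_i\in\mathbb R$) constitute a 7-dimensional representation of $\mathbf{SU}(2)\times\mathbf{SU}(2)$. For such $h$, $h\,\mathbb M^8\,h^t\subset\mathbb M^8$, and $\rho$ is the representation on $\mathbb R^8$ given by $\rho(h)\vec X=\iota^{-1}\big(h\,\iota(\vec X)\,h^t\big)$. *)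

theory Defs
  imports "HOL-Analysis.Analysis" "HOL-Computational_Algebra.Polynomial"
begin

text \<open>
  The index types \<open>6\<close>, \<open>7\<close>, \<open>8\<close> are those of \<^theory>\<open>HOL-Library.Numeral_Type\<close>, i.e. residues; the last
  index \<open>n :: n\<close> equals \<open>0\<close>.  Hence components are addressed as \<open>$ 1, \<dots>, $ n\<close>, in agreement
  with the list notation of \<^const>\<open>vector\<close>, but the order relation on indices is never used.
\<close>

subsection \<open>The space of matrices and the tensor\<close>

definition alpha :: "real^8 \<Rightarrow> real^4^3" where
  "alpha x = vector
    [vector [- x$3 + sqrt 3 * x$4, - x$5 + sqrt 3 * x$6, - x$7 + sqrt 3 * x$8, - 2 * x$1],
     vector [- x$1 - sqrt 3 * x$2, x$7 + sqrt 3 * x$8, - x$5 - sqrt 3 * x$6, 2 * x$3],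
     vector [- 2 * x$7, x$1 - sqrt 3 * x$2, - x$3 - sqrt 3 * x$4, - 2 * x$5]]"

definition iota :: "real^8 \<Rightarrow> real^7^7" where
  "iota x = (let a = alpha x in vector
    [vector [0, 0, 0, a$1$1, a$1$2, a$1$3, a$1$4],
     vector [0, 0, 0, a$2$1, a$2$2, a$2$3, a$2$4],
     vector [0, 0, 0, a$3$1, a$3$2, a$3$3, a$3$4],
     vector [- a$1$1, - a$2$1, - a$3$1, 0, 0, 0, 0],
     vector [- a$1$2, - a$2$2, - a$3$2, 0, 0, 0, 0],
     vector [- a$1$3, - a$2$3, - a$3$3, 0, 0, 0, 0],
     vector [- a$1$4, - a$2$4, - a$3$4, 0, 0, 0, 0]])"

text \<open>The polynomial \<open>det (iota x - \<lambda> I)\<close> in the indeterminate \<open>\<lambda>\<close>.\<close>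

definition char_det :: "real^8 \<Rightarrow> real poly" where
  "char_det x = det (\<chi> i j. [:iota x $ i $ j:] - (if i = j then [:0, 1:] else 0))"

text \<open>
  \<open>char_det x = - \<lambda>^7 - 6 g \<lambda>^5 - 9 g\<^sup>2 \<lambda>^3 + 2 \<Phi> \<lambda>\<close> with \<open>g = x \<bullet> x\<close>; \<open>\<Phi>\<close> is read off from the
  linear coefficient.
\<close>

definition Phi :: "real^8 \<Rightarrow> real" where
  "Phi x = coeff (char_det x) 1 / 2"

definition F :: "real^8 \<Rightarrow> real" where
  "F x = Phi x + (x \<bullet> x) ^ 3"

text \<open>A covariant tensor of order 6 is given by its components; a multi-index is a function \<open>6 \<Rightarrow> 8\<close>.\<close>

type_synonym tensor6 = "(6 \<Rightarrow> 8) \<Rightarrow> real"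

definition symmetric_tensor :: "tensor6 \<Rightarrow> bool" where
  "symmetric_tensor T \<longleftrightarrow> (\<forall>p I. bij p \<longrightarrow> T (I \<circ> p) = T I)"

definition tensor_form :: "tensor6 \<Rightarrow> real^8 \<Rightarrow> real" where
  "tensor_form T x = (\<Sum>I\<in>UNIV. T I * (\<Prod>k\<in>UNIV. x $ I k))"

definition Upsilon :: tensor6 where
  "Upsilon = (THE T. symmetric_tensor T \<and> (\<forall>x. tensor_form T x = F x))"

text \<open>
  Pull-back \<open>T(A \<cdot>, \<dots>, A \<cdot>)\<close>.  The left action of \<open>GL(8)\<close> is the pull-back along \<open>A\<inverse>\<close>, which has the
  same stabilizers.
\<close>

definition pullback :: "real^8^8 \<Rightarrow> tensor6 \<Rightarrow> tensor6" where
  "pullback A T = (\<lambda>I. \<Sum>J\<in>UNIV. T J * (\<Prod>k\<in>UNIV. A $ J k $ I k))"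

definition stabilizer :: "tensor6 \<Rightarrow> (real^8^8) set" where
  "stabilizer T = {A. invertible A \<and> pullback A T = T}"

definition SO8 :: "(real^8^8) set" where
  "SO8 = {A. orthogonal_matrix A \<and> det A = 1}"

subsection \<open>The representation\<close>

text \<open>
  \<^const>\<open>times\<close> on \<open>'a^'n^'n\<close> is componentwise, so the library's \<^const>\<open>exp\<close> is not the matrix
  exponential.
\<close>

definition mexp :: "'a::real_normed_field^'n^'n \<Rightarrow> 'a^'n^'n" where
  "mexp A = (\<Sum>n. (1 / fact n) *\<^sub>R (((**) A ^^ n) (mat 1)))"

definition E_mat :: "7 \<Rightarrow> 7 \<Rightarrow> real^7^7" where
  "E_mat a b = (\<chi> i j. if i = a \<and> j = b then 1 else 0)"

definition L_mat :: "7 \<Rightarrow> 7 \<Rightarrow> real^7^7" where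
  "L_mat a b = E_mat a b - E_mat b a"

definition s1 :: "real^7^7" where "s1 = (1/2) *\<^sub>R (L_mat 4 5 - L_mat 6 7)"
definition s2 :: "real^7^7" where "s2 = (1/2) *\<^sub>R (L_mat 4 6 + L_mat 5 7)"
definition s3 :: "real^7^7" where "s3 = (1/2) *\<^sub>R (L_mat 4 7 - L_mat 5 6)"
definition \<sigma>1 :: "real^7^7" where "\<sigma>1 = - L_mat 1 2 - (1/2) *\<^sub>R (L_mat 4 7 + L_mat 5 6)"
definition \<sigma>2 :: "real^7^7" where "\<sigma>2 = L_mat 1 3 + (1/2) *\<^sub>R (L_mat 4 6 - L_mat 5 7)"
definition \<sigma>3 :: "real^7^7" where "\<sigma>3 = L_mat 2 3 - (1/2) *\<^sub>R (L_mat 4 5 + L_mat 6 7)"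

definition h_mat :: "real \<Rightarrow> real \<Rightarrow> real \<Rightarrow> real \<Rightarrow> real \<Rightarrow> real \<Rightarrow> real^7^7" where
  "h_mat t1 t2 t3 \<tau>1 \<tau>2 \<tau>3 =
     mexp (t1 *\<^sub>R s1) ** mexp (t2 *\<^sub>R s2) ** mexp (t3 *\<^sub>R s3) **
     mexp (\<tau>1 *\<^sub>R \<sigma>1) ** mexp (\<tau>2 *\<^sub>R \<sigma>2) ** mexp (\<tau>3 *\<^sub>R \<sigma>3)"

definition H7 :: "(real^7^7) set" where
  "H7 = {h_mat t1 t2 t3 \<tau>1 \<tau>2 \<tau>3 | t1 t2 t3 \<tau>1 \<tau>2 \<tau>3. True}"

text \<open>
  \<open>iota\<close> is injective and, for \<open>h \<in> H7\<close>, \<open>h ** iota x ** transpose h\<close> lies in its range; so \<open>inv iota\<close>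
  is a genuine inverse here and \<open>rho h\<close> is the matrix of a linear map.
\<close>

definition rho :: "real^7^7 \<Rightarrow> real^8^8" where
  "rho h = matrix (\<lambda>x. inv iota (h ** iota x ** transpose h))"

subsection \<open>\<open>SU(2) \<times> SU(2)\<close> and its representations\<close>

definition SU2 :: "(complex^2^2) set" where
  "SU2 = {U. U ** (\<chi> i j. cnj (U $ j $ i)) = mat 1 \<and> det U = 1}"

text \<open>The basis \<open>- \<i>/2\<close> times the Pauli matrices of \<open>su(2)\<close>: \<open>[e\<^sub>j, e\<^sub>k] = \<epsilon>\<^sub>i\<^sub>j\<^sub>k e\<^sub>i\<close>.\<close>

definition e1 :: "complex^2^2" where
  "e1 = vector [vector [0, - \<i>/2], vector [- \<i>/2, 0]]"
definition e2 :: "complex^2^2" where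
  "e2 = vector [vector [0, - 1/2], vector [1/2, 0]]"
definition e3 :: "complex^2^2" where
  "e3 = vector [vector [- \<i>/2, 0], vector [0, \<i>/2]]"

definition su2_prod :: "real \<Rightarrow> real \<Rightarrow> real \<Rightarrow> complex^2^2" where
  "su2_prod t1 t2 t3 = mexp (t1 *\<^sub>R e1) ** mexp (t2 *\<^sub>R e2) ** mexp (t3 *\<^sub>R e3)"

definition SU2xSU2_rep :: "((complex^2^2) \<times> (complex^2^2) \<Rightarrow> real^'n^'n) \<Rightarrow> bool" where
  "SU2xSU2_rep \<phi> \<longleftrightarrow>
     continuous_on (SU2 \<times> SU2) \<phi> \<and> \<phi> (mat 1, mat 1) = mat 1 \<and>
     (\<forall>u\<in>SU2. \<forall>v\<in>SU2. \<forall>u'\<in>SU2. \<forall>v'\<in>SU2. \<phi> (u ** u', v ** v') = \<phi> (u, v) ** \<phi> (u', v'))"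

definition irreducible_SU2xSU2_rep :: "((complex^2^2) \<times> (complex^2^2) \<Rightarrow> real^'n^'n) \<Rightarrow> bool" where
  "irreducible_SU2xSU2_rep \<phi> \<longleftrightarrow> SU2xSU2_rep \<phi> \<and>
     (\<forall>W. subspace W \<and> (\<forall>g\<in>SU2 \<times> SU2. \<forall>x\<in>W. \<phi> g *v x \<in> W) \<longrightarrow> W = {0} \<or> W = UNIV)"

end

theory Submission
  imports Defs
begin

text \<open>
  Writing \<open>a\<close> for the \<open>3 \<times> 4\<close> block of \<open>iota x\<close>, block elimination gives \<open>F x = (x \<bullet> x)\<^sup>3 - det (a a\<^sup>t) / 2\<close>, and
  \<open>SU(2) \<times> SU(2)\<close> acts by \<open>a \<mapsto> R a (L Q)\<^sup>t\<close>, where \<open>L\<close> and \<open>Q\<close> are commuting quaternion multiplications on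
  \<open>\<real>\<^sup>4\<close> and \<open>R\<close> is the rotation of \<open>\<real>\<^sup>3\<close> belonging to \<open>Q\<close>; hence \<open>F\<close> is invariant.

  Conversely, the linear vector fields annihilating \<open>F\<close> form exactly the Lie algebra \<open>su(2) \<oplus> su(2)\<close> of the group;
  this is linear algebra, carried out by evaluating the derivative of \<open>F\<close> at 58 points.  A linear automorphism of
  \<open>F\<close> normalizes this Lie algebra.  Its first factor is singled out as containing the elements of square \<open>- 1\<close>,
  its second one as the centralizer of the first, so both are preserved; every automorphism of \<open>su(2)\<close> is inner, and
  after multiplication with a group element the automorphism commutes with everything.  By Schur's lemma it is then a
  scalar \<open>c\<close> with \<open>c\<^sup>6 = 1\<close>, and \<open>- 1\<close> belongs to the group.
\<close>

section \<open>Block matrices\<close>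

text \<open>The Lie algebra of a stabilizer says nothing about its components other than that of the
  identity; conjugating by a single given automorphism treats all components at once and takes the
  place of any theory of closed subgroups. The two factors cannot be interchanged because the
  representation is spin 1/2 tensor spin 3/2: in the normalization of \<open>QL\<close> and
  \<open>QR\<close>, a unit imaginary quaternion of the first factor has eigenvalues i and -i, one
  of the second factor i, -i, 3i and -3i. Both spins are quaternionic, so their tensor product is of
  real type and the commutant consists of real scalars only. Orthogonality and determinant 1 are not
  derived from the invariance of F directly; they are read off from the explicit group once the
  stabilizer is known.\<close>

lemma exhaust_7: "(x::7) = 1 \<or> x = 2 \<or> x = 3 \<or> x = 4 \<or> x = 5 \<or> x = 6 \<or> x = 7"
proof (induct x)
  case (of_int z)
  then have "0 \<le> z" "z < 7" by simp_all
  then have "z = 0 \<or> z = 1 \<or> z = 2 \<or> z = 3 \<or> z = 4 \<or> z = 5 \<or> z = 6" by arith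
  then show ?case by auto
qed

lemma exhaust_8: "(x::8) = 1 \<or> x = 2 \<or> x = 3 \<or> x = 4 \<or> x = 5 \<or> x = 6 \<or> x = 7 \<or> x = 8"
proof (induct x)
  case (of_int z)
  then have "0 \<le> z" "z < 8" by simp_all
  then have "z = 0 \<or> z = 1 \<or> z = 2 \<or> z = 3 \<or> z = 4 \<or> z = 5 \<or> z = 6 \<or> z = 7" by arith
  then show ?case by auto
qed

lemma forall_7: "(\<forall>i::7. P i) \<longleftrightarrow> P 1 \<and> P 2 \<and> P 3 \<and> P 4 \<and> P 5 \<and> P 6 \<and> P 7"
  by (metis exhaust_7)

lemma forall_8: "(\<forall>i::8. P i) \<longleftrightarrow> P 1 \<and> P 2 \<and> P 3 \<and> P 4 \<and> P 5 \<and> P 6 \<and> P 7 \<and> P 8"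
  by (metis exhaust_8)

lemma UNIV_7: "UNIV = {1::7, 2, 3, 4, 5, 6, 7}"
  using exhaust_7 by auto

lemma UNIV_8: "UNIV = {1::8, 2, 3, 4, 5, 6, 7, 8}"
  using exhaust_8 by auto

lemma sum_7: "sum f (UNIV::7 set) = f 1 + f 2 + f 3 + f 4 + f 5 + f 6 + f 7"
  unfolding UNIV_7 by (simp add: ac_simps)

lemma sum_8: "sum f (UNIV::8 set) = f 1 + f 2 + f 3 + f 4 + f 5 + f 6 + f 7 + f 8"
  unfolding UNIV_8 by (simp add: ac_simps)

lemma vector_4 [simp]:
  "(vector [a,b,c,d] :: 'a::zero^4) $ 1 = a"
  "(vector [a,b,c,d] :: 'a^4) $ 2 = b"
  "(vector [a,b,c,d] :: 'a^4) $ 3 = c"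
  "(vector [a,b,c,d] :: 'a^4) $ 4 = d"
  by (simp_all add: vector_def)

lemma vector_7 [simp]:
  "(vector [a,b,c,d,e,f,g] :: 'a::zero^7) $ 1 = a"
  "(vector [a,b,c,d,e,f,g] :: 'a^7) $ 2 = b"
  "(vector [a,b,c,d,e,f,g] :: 'a^7) $ 3 = c"
  "(vector [a,b,c,d,e,f,g] :: 'a^7) $ 4 = d"
  "(vector [a,b,c,d,e,f,g] :: 'a^7) $ 5 = e"
  "(vector [a,b,c,d,e,f,g] :: 'a^7) $ 6 = f"
  "(vector [a,b,c,d,e,f,g] :: 'a^7) $ 7 = g"
  by (simp_all add: vector_def)

lemma vector_8 [simp]:
  "(vector [a,b,c,d,e,f,g,h] :: 'a::zero^8) $ 1 = a"
  "(vector [a,b,c,d,e,f,g,h] :: 'a^8) $ 2 = b"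
  "(vector [a,b,c,d,e,f,g,h] :: 'a^8) $ 3 = c"
  "(vector [a,b,c,d,e,f,g,h] :: 'a^8) $ 4 = d"
  "(vector [a,b,c,d,e,f,g,h] :: 'a^8) $ 5 = e"
  "(vector [a,b,c,d,e,f,g,h] :: 'a^8) $ 6 = f"
  "(vector [a,b,c,d,e,f,g,h] :: 'a^8) $ 7 = g"
  "(vector [a,b,c,d,e,f,g,h] :: 'a^8) $ 8 = h"
  by (simp_all add: vector_def)

definition bd :: "'a::comm_ring_1^3^3 \<Rightarrow> 'a^4^4 \<Rightarrow> 'a^7^7" where
  "bd R Q = vector
    [vector [R$1$1, R$1$2, R$1$3, 0, 0, 0, 0],
     vector [R$2$1, R$2$2, R$2$3, 0, 0, 0, 0],
     vector [R$3$1, R$3$2, R$3$3, 0, 0, 0, 0],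
     vector [0, 0, 0, Q$1$1, Q$1$2, Q$1$3, Q$1$4],
     vector [0, 0, 0, Q$2$1, Q$2$2, Q$2$3, Q$2$4],
     vector [0, 0, 0, Q$3$1, Q$3$2, Q$3$3, Q$3$4],
     vector [0, 0, 0, Q$4$1, Q$4$2, Q$4$3, Q$4$4]]"

definition offd :: "'a::comm_ring_1^4^3 \<Rightarrow> 'a^3^4 \<Rightarrow> 'a^7^7" where
  "offd a b = vector
    [vector [0, 0, 0, a$1$1, a$1$2, a$1$3, a$1$4],
     vector [0, 0, 0, a$2$1, a$2$2, a$2$3, a$2$4],
     vector [0, 0, 0, a$3$1, a$3$2, a$3$3, a$3$4],
     vector [b$1$1, b$1$2, b$1$3, 0, 0, 0, 0],
     vector [b$2$1, b$2$2, b$2$3, 0, 0, 0, 0],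
     vector [b$3$1, b$3$2, b$3$3, 0, 0, 0, 0],
     vector [b$4$1, b$4$2, b$4$3, 0, 0, 0, 0]]"

lemma iota_offd: "iota x = offd (alpha x) (- transpose (alpha x))"
  by (simp add: iota_def offd_def transpose_def Let_def)

lemma bd_mult: "bd R Q ** bd R' Q' = bd (R ** R') (Q ** Q')"
  by (simp add: vec_eq_iff forall_7 matrix_matrix_mult_def sum_7 bd_def sum_3 sum_4)

lemma bd_offd: "bd R Q ** offd a b = offd (R ** a) (Q ** b)"
  by (simp add: vec_eq_iff forall_7 matrix_matrix_mult_def sum_7 bd_def offd_def sum_3 sum_4)

lemma offd_bd: "offd a b ** bd R Q = offd (a ** Q) (b ** R)"
  by (simp add: vec_eq_iff forall_7 matrix_matrix_mult_def sum_7 bd_def offd_def sum_3 sum_4)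

lemma transpose_bd: "transpose (bd R Q) = bd (transpose R) (transpose Q)"
  by (simp add: vec_eq_iff forall_7 transpose_def bd_def)

lemma bd_one: "bd (mat 1) (mat 1) = mat 1"
  by (simp add: vec_eq_iff forall_7 mat_def bd_def)

lemma bd_add: "bd R Q + bd R' Q' = bd (R + R') (Q + Q')"
  by (simp add: vec_eq_iff forall_7 bd_def)

lemma offd_inject: "offd a b = offd a' b' \<longleftrightarrow> a = a' \<and> b = b'"
  by (auto simp add: vec_eq_iff forall_7 forall_3 forall_4 offd_def)

lemma scaleR_bd: "t *\<^sub>R bd R Q = bd (t *\<^sub>R R) (t *\<^sub>R (Q::real^4^4))"
  by (simp add: vec_eq_iff forall_7 bd_def)

section \<open>Coordinates on the range of \<open>alpha\<close>\<close>

lemma sqrt3_sqrt3: "sqrt 3 * (sqrt 3 * x) = 3 * x"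
  by (simp flip: mult.assoc)

text \<open>A linear left inverse of \<open>alpha\<close> defined on all matrices: the odd
  coordinates stand alone in the entries (1,4), (2,4), (3,4), (3,1), and the even ones follow by
  elimination. It replaces \<open>inv iota\<close> by an explicit formula.\<close>

definition proj8 :: "real^4^3 \<Rightarrow> real^8" where
  "proj8 a = vector [- a$1$4/2, sqrt 3 * (a$1$4/6 - a$2$1/3), a$2$4/2, sqrt 3 * (a$1$1/3 + a$2$4/6),
                     - a$3$4/2, sqrt 3 * (a$1$2/3 - a$3$4/6), - a$3$1/2, sqrt 3 * (a$1$3/3 - a$3$1/6)]"

text \<open>Equations for the range of \<open>alpha\<close>. The 3 by 4 matrices carry spin 1 tensor
  (1/2, 1/2), which is (1/2, 3/2) plus (1/2, 1/2), of dimensions 8 and 4; the four equations remove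
  the second summand.\<close>

definition alpha_space :: "(real^4^3) set" where
  "alpha_space = {a. a$1$1 + a$2$4 + a$3$3 = 0 \<and> a$1$2 + a$2$3 - a$3$4 = 0 \<and>
                     a$2$2 - a$1$3 + a$3$1 = 0 \<and> a$2$1 - a$3$2 - a$1$4 = 0}"

lemma proj8_alpha: "proj8 (alpha x) = x"
  by (simp add: vec_eq_iff forall_8 proj8_def alpha_def field_simps)

lemma alpha_proj8: "a \<in> alpha_space \<Longrightarrow> alpha (proj8 a) = a"
  by (simp add: vec_eq_iff forall_3 forall_4 proj8_def alpha_def alpha_space_def algebra_simps sqrt3_sqrt3)

lemma linear_alpha: "linear alpha"
  by (rule linearI) (simp_all add: vec_eq_iff forall_3 forall_4 alpha_def algebra_simps)

lemma linear_proj8: "linear proj8"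
  by (rule linearI) (simp_all add: vec_eq_iff forall_8 proj8_def field_simps)

lemma inj_alpha: "alpha x = alpha y \<longleftrightarrow> x = y"
  by (metis proj8_alpha)

lemma inj_iota: "inj iota"
  by (auto simp: inj_def iota_offd offd_inject inj_alpha)

lemma sum_squares_alpha: "(\<Sum>i\<in>UNIV. \<Sum>j\<in>UNIV. alpha x $ i $ j * alpha y $ i $ j) = 6 * (x \<bullet> y)"
  by (simp add: sum_3 sum_4 alpha_def inner_vec_def sum_8 algebra_simps sqrt3_sqrt3)

section \<open>The characteristic polynomial\<close>

lemma poly_det: "poly (det A) l = det (\<chi> i j. poly (A $ i $ j) l)"
  by (simp add: det_def poly_sum poly_prod)

text \<open>In the Leibniz expansion, a permutation moving one of the last four indices meets a
  zero, since those rows have only their diagonal entry. What remains is the expansion of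
  \<open>det R\<close>, multiplied by the four diagonal entries.\<close>

lemma det_bd_offd_upper:
  "det (bd R (mat d) + offd a 0) = det R * d ^ 4"
proof -
  let ?A = "bd R (mat d) + offd a 0"
  have f123: "finite {2::7, 3}" "1 \<notin> {2::7, 3}" and f23: "finite {3::7}" "2 \<notin> {3::7}"
    by auto
  have "det ?A = (\<Sum>p | p permutes {1,2,3}. of_int (sign p) * (\<Prod>i\<in>UNIV. ?A $ i $ p i))"
    unfolding det_def
  proof (rule sum.mono_neutral_right)
    show "{p. p permutes {1::7,2,3}} \<subseteq> {p. p permutes UNIV}"
      using permutes_subset by blast
    show "\<forall>p\<in>{p. p permutes UNIV} - {p. p permutes {1,2,3}}.
        of_int (sign p) * (\<Prod>i\<in>UNIV. ?A $ i $ p i) = 0"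
    proof
      fix p :: "7 \<Rightarrow> 7"
      assume p: "p \<in> {p. p permutes UNIV} - {p. p permutes {1,2,3}}"
      have "\<exists>i\<in>{4,5,6,7}. p i \<noteq> i"
      proof (rule ccontr)
        assume "\<not> ?thesis"
        then have "p permutes {1,2,3}"
          using p exhaust_7 by (auto simp: permutes_def)
        then show False using p by auto
      qed
      then obtain i where i: "i \<in> {4,5,6,7}" "p i \<noteq> i" by blast
      then have "?A $ i $ p i = 0"
        using exhaust_7[of "p i"] by (auto simp: bd_def offd_def mat_def)
      then have "(\<Prod>i\<in>UNIV. ?A $ i $ p i) = 0" by (intro prod_zero) auto
      then show "of_int (sign p) * (\<Prod>i\<in>UNIV. ?A $ i $ p i) = 0" by simp
    qed
  qed simp
  also have "\<dots> = (\<Sum>p | p permutes {1,2,3}. of_int (sign p) * (\<Prod>i\<in>{1,2,3}. ?A $ i $ p i)) * d ^ 4"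
    unfolding sum_distrib_right
  proof (rule sum.cong)
    fix p :: "7 \<Rightarrow> 7" assume "p \<in> {p. p permutes {1,2,3}}"
    then have "p 4 = 4" "p 5 = 5" "p 6 = 6" "p 7 = 7"
      by (auto simp: permutes_def)
    then have "(\<Prod>i\<in>UNIV. ?A $ i $ p i) = (\<Prod>i\<in>{1,2,3}. ?A $ i $ p i) * d ^ 4"
      unfolding UNIV_7 by (simp add: bd_def offd_def mat_def power4_eq_xxxx mult.assoc)
    then show "of_int (sign p) * (\<Prod>i\<in>UNIV. ?A $ i $ p i) =
        of_int (sign p) * (\<Prod>i\<in>{1,2,3}. ?A $ i $ p i) * d ^ 4"
      by (simp add: mult.assoc)
  qed simp
  also have "(\<Sum>p | p permutes {1,2,3}. of_int (sign p) * (\<Prod>i\<in>{1,2,3}. ?A $ i $ p i)) = det R"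
    unfolding sum_over_permutations_insert[OF f123] sum_over_permutations_insert[OF f23] permutes_sing
    by (simp add: sign_swap_id permutation_swap_id sign_compose sign_id swap_id_eq det_3 bd_def offd_def)
  finally show ?thesis .
qed

text \<open>Right multiplication by the block matrix with rows (l, 0) and (b, 1), of determinant
  \<open>l ^ 3\<close>, clears the lower left block. The powers of l stay on both sides because l
  may be a zero divisor here; they are cancelled later, between polynomials.\<close>

lemma det_charpoly_offd:
  fixes a :: "'a::comm_ring_1^4^3"
  shows "det (offd a b - mat l) * l ^ 3 = det (a ** b - mat (l\<^sup>2)) * l ^ 4"
proof -
  let ?N = "bd (mat l) (mat 1) + offd 0 b"
  have "transpose ?N = bd (mat l) (mat 1) + offd (transpose b) 0"
    by (simp add: vec_eq_iff forall_7 transpose_def bd_def offd_def mat_def)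
  then have "det ?N = det (mat l :: 'a^3^3)"
    by (metis det_transpose det_bd_offd_upper mult_1_right power_one)
  then have N: "det ?N = l ^ 3"
    by (simp add: det_3 mat_def power3_eq_cube)
  have "(offd a b - mat l) ** ?N = bd (a ** b - mat (l\<^sup>2)) (mat (- l)) + offd a 0"
    by (simp add: vec_eq_iff forall_7 matrix_matrix_mult_def sum_7 sum_4 bd_def offd_def mat_def power2_eq_square algebra_simps)
  then have "det (offd a b - mat l) * det ?N = det (a ** b - mat (l\<^sup>2)) * (- l) ^ 4"
    by (simp add: det_bd_offd_upper flip: det_mul)
  then show ?thesis by (simp add: N)
qed

lemma poly_char_det: "poly (char_det x) l = det (iota x - mat l)"
  unfolding char_det_def poly_det by (rule arg_cong[of _ _ det]) (simp add: vec_eq_iff mat_def)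

definition gram :: "real^8 \<Rightarrow> real^3^3" where
  "gram x = alpha x ** transpose (alpha x)"

lemma Phi_eq: "Phi x = - det (gram x) / 2"
proof -
  let ?S = "gram x"
  define q where "q = [:- det ?S, 0,
    - (?S$1$1 * ?S$2$2 - ?S$1$2 * ?S$2$1 + ?S$1$1 * ?S$3$3 - ?S$1$3 * ?S$3$1 + ?S$2$2 * ?S$3$3 - ?S$2$3 * ?S$3$2), 0,
    - (?S$1$1 + ?S$2$2 + ?S$3$3), 0, - 1:]"
  have q: "poly q l = det (- ?S - mat (l\<^sup>2))" for l
    by (simp add: q_def det_3 mat_def power2_eq_square algebra_simps)
  have "alpha x ** - transpose (alpha x) = - ?S"
    by (simp add: gram_def vec_eq_iff matrix_matrix_mult_def sum_negf)
  \<comment> \<open>Agreement at every real l is an identity of real polynomials, and there the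
    factor \<open>[:0, 1:] ^ 3\<close> can be cancelled. The linear coefficient of
    \<open>[:0, 1:] * q\<close> is then the constant term of q.\<close>
  then have "poly (char_det x * [:0, 1:] ^ 3) l = poly (([:0, 1:] * q) * [:0, 1:] ^ 3) l" for l
    using det_charpoly_offd[of "alpha x" "- transpose (alpha x)" l]
    by (simp add: poly_char_det iota_offd q power4_eq_xxxx power3_eq_cube algebra_simps)
  then have "char_det x * [:0, 1:] ^ 3 = ([:0, 1:] * q) * [:0, 1:] ^ 3"
    by (subst poly_eq_poly_eq_iff[symmetric]) (rule ext)
  then have "char_det x = [:0, 1:] * q"
    by (subst (asm) mult_right_cancel) auto
  then show ?thesis by (simp add: Phi_def q_def)
qed

lemma F_eq: "F x = (x \<bullet> x) ^ 3 - det (gram x) / 2"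
  by (simp add: F_def Phi_eq)

section \<open>Symmetric tensors and sextic forms\<close>

text \<open>A separate vector in every slot: polarization needs this, since it feeds different
  vectors into the tensor.\<close>

definition multi :: "tensor6 \<Rightarrow> (6 \<Rightarrow> real^8) \<Rightarrow> real" where
  "multi T v = (\<Sum>I\<in>UNIV. T I * (\<Prod>k\<in>UNIV. v k $ I k))"

lemma tensor_form_multi: "tensor_form T x = multi T (\<lambda>_. x)"
  by (simp add: tensor_form_def multi_def)

lemma multi_axis: "multi T (\<lambda>k. axis (J k) 1) = T J"
proof -
  have "(\<Prod>k\<in>UNIV. axis (J k) 1 $ I k) = (if I = J then 1 else (0::real))" for I :: "6 \<Rightarrow> 8"
    by (auto simp: axis_def fun_eq_iff)
  then show ?thesis unfolding multi_def by (simp only: mult_delta_right) simp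
qed

lemma multi_sum_vectors:
  fixes v :: "6 \<Rightarrow> real^8"
  shows "multi T (\<lambda>_. \<Sum>m\<in>S. v m) = (\<Sum>f | range f \<subseteq> S. multi T (v \<circ> f))"
proof -
  have P: "PiE UNIV (\<lambda>_. S) = {f :: 6 \<Rightarrow> 6. range f \<subseteq> S}" by (auto simp: PiE_def)
  have "multi T (\<lambda>_. \<Sum>m\<in>S. v m) = (\<Sum>I\<in>UNIV. T I * (\<Prod>k\<in>UNIV. \<Sum>m\<in>S. v m $ I k))"
    by (simp add: multi_def)
  also have "\<dots> = (\<Sum>I\<in>UNIV. \<Sum>f | range f \<subseteq> S. T I * (\<Prod>k\<in>UNIV. v (f k) $ I k))"
    by (simp add: prod_sum_PiE P sum_distrib_left)
  also have "\<dots> = (\<Sum>f | range f \<subseteq> S. multi T (v \<circ> f))"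
    by (subst sum.swap) (simp add: multi_def)
  finally show ?thesis .
qed

text \<open>Adding or removing a fixed element m outside A pairs the supersets of A with opposite
  signs.\<close>

lemma sum_supersets_alternating:
  fixes A :: "'a::finite set"
  assumes "A \<noteq> UNIV"
  shows "(\<Sum>S | A \<subseteq> S. (-1) ^ card S) = (0::real)"
proof -
  obtain m where m: "m \<notin> A" using assms by blast
  let ?P = "{S. A \<subseteq> S \<and> m \<notin> S}"
  have eq: "{S. A \<subseteq> S} = ?P \<union> insert m ` ?P"
  proof -
    have "S \<in> insert m ` ?P" if "A \<subseteq> S" "m \<in> S" for S
      using that m by (intro image_eqI[of _ _ "S - {m}"]) auto
    then show ?thesis by auto
  qed
  have inj: "inj_on (insert m) ?P" by (auto simp: inj_on_def)
  have "(\<Sum>S | A \<subseteq> S. (-1) ^ card S) = (\<Sum>S\<in>?P. (-1) ^ card S) + (\<Sum>S\<in>?P. (-1) ^ card (insert m S) :: real)"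
    unfolding eq by (subst sum.union_disjoint) (auto simp: sum.reindex[OF inj])
  also have "\<dots> = 0" by (simp add: sum_negf)
  finally show ?thesis .
qed

text \<open>Inclusion-exclusion: expanding the form at a partial sum over S gives the maps f from
  slots to slots with range in S, and the alternating sum over S keeps only the surjective f. These
  are the permutations, each contributing \<open>T J\<close> by symmetry; the sign of the full set
  is 1 because it has 6 elements.\<close>

lemma symmetric_tensor_polarization:
  assumes T: "symmetric_tensor T"
  shows "(\<Sum>S\<in>UNIV. (-1) ^ card S * tensor_form T (\<Sum>m\<in>S. axis (J m) 1)) = fact 6 * T J"
proof -
  have v: "(\<lambda>m. axis (J m) 1) \<circ> f = (\<lambda>k. axis ((J \<circ> f) k) 1)" for f :: "6 \<Rightarrow> 6" by auto
  have "(\<Sum>S\<in>UNIV. (-1) ^ card S * tensor_form T (\<Sum>m\<in>S. axis (J m) 1)) =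
        (\<Sum>S\<in>UNIV. \<Sum>f\<in>UNIV. if range f \<subseteq> S then (-1) ^ card S * T (J \<circ> f) else 0)"
    unfolding tensor_form_multi multi_sum_vectors v multi_axis
    by (auto simp: sum_distrib_left sum.If_cases Int_def o_def intro!: sum.cong)
  also have "\<dots> = (\<Sum>f\<in>UNIV. (\<Sum>S | range f \<subseteq> S. (-1) ^ card S) * T (J \<circ> f))"
    by (subst sum.swap) (simp add: sum_distrib_right sum.If_cases Int_def)
  also have "\<dots> = (\<Sum>f | bij (f :: 6 \<Rightarrow> 6). T J)"
  proof (rule sum.mono_neutral_cong_right)
    show "\<forall>f\<in>UNIV - {f. bij f}. (\<Sum>S | range f \<subseteq> S. (-1) ^ card S) * T (J \<circ> f) = 0"
    proof
      fix f :: "6 \<Rightarrow> 6" assume "f \<in> UNIV - {f. bij f}"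
      then have "range f \<noteq> UNIV"
        using finite_UNIV_surj_inj[of f] by (auto simp: bij_def)
      then show "(\<Sum>S | range f \<subseteq> S. (-1) ^ card S) * T (J \<circ> f) = 0"
        by (simp add: sum_supersets_alternating)
    qed
    show "(\<Sum>S | range f \<subseteq> S. (-1) ^ card S) * T (J \<circ> f) = T J" if "f \<in> {f. bij f}" for f
    proof -
      have "{S. range f \<subseteq> S} = {UNIV}" using that by (auto simp: bij_def)
      then show ?thesis using that T by (simp add: symmetric_tensor_def)
    qed
  qed auto
  also have "\<dots> = fact 6 * T J"
  proof -
    have "{f :: 6 \<Rightarrow> 6. bij f} = {f. f permutes UNIV}"
      by (simp add: permutes_univ bij_iff)
    then show ?thesis by (simp add: card_permutations[OF refl finite_class.finite_UNIV])
  qed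
  finally show ?thesis .
qed

lemma symmetric_tensor_eqI:
  assumes "symmetric_tensor T" "symmetric_tensor T'" "\<And>x. tensor_form T x = tensor_form T' x"
  shows "T = T'"
proof
  fix J show "T J = T' J"
    using symmetric_tensor_polarization[OF assms(1), of J] symmetric_tensor_polarization[OF assms(2), of J]
    by (simp add: assms(3))
qed

lemma prod_bij_UNIV:
  fixes p :: "'a::finite \<Rightarrow> 'a"
  assumes "bij p"
  shows "(\<Prod>k\<in>UNIV. g (p k)) = (\<Prod>k\<in>UNIV. g k)"
  using assms by (rule prod.reindex_bij_betw)

lemma sum_comp_bij:
  fixes p :: "'a::finite \<Rightarrow> 'a" and g :: "('a \<Rightarrow> 'b::finite) \<Rightarrow> 'c::comm_monoid_add"
  assumes "bij p"
  shows "(\<Sum>I\<in>UNIV. g (I \<circ> p)) = (\<Sum>I\<in>UNIV. g I)"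
proof (rule sum.reindex_bij_betw)
  show "bij_betw (\<lambda>I. I \<circ> p) UNIV (UNIV :: ('a \<Rightarrow> 'b) set)"
    using assms by (intro bij_betw_byWitness[where f' = "\<lambda>I. I \<circ> inv p"])
      (auto simp: o_def bij_is_inj bij_is_surj surj_f_inv_f)
qed

text \<open>Average T over all permutations of its slots. Expanding F into products of linear forms
  yields a tensor without symmetry, so this supplies the existence of
  \<open>Upsilon\<close>.\<close>

lemma ex_symmetric_tensor:
  "\<exists>T'. symmetric_tensor T' \<and> (\<forall>x. tensor_form T' x = tensor_form T x)"
proof (intro exI conjI allI)
  let ?B = "{p :: 6 \<Rightarrow> 6. bij p}"
  define T' where "T' = (\<lambda>I. (\<Sum>p\<in>?B. T (I \<circ> p)) / card ?B)"
  have "id \<in> ?B" by auto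
  then have B: "card ?B > 0" by (auto simp: card_gt_0_iff)
  show "symmetric_tensor T'"
    unfolding symmetric_tensor_def
  proof (intro allI impI)
    fix q :: "6 \<Rightarrow> 6" and I :: "6 \<Rightarrow> 8" assume q: "bij q"
    have "bij_betw (\<lambda>p. q \<circ> p) ?B ?B"
      using q by (intro bij_betw_byWitness[where f' = "\<lambda>p. inv q \<circ> p"])
        (auto simp: bij_comp bij_imp_bij_inv bij_is_inj surj_iff[THEN iffD1] bij_is_surj simp flip: o_assoc intro: bij_comp,
         auto simp: o_assoc bij_is_inj surj_iff[THEN iffD1] bij_is_surj)
    then have "(\<Sum>p\<in>?B. T (I \<circ> (q \<circ> p))) = (\<Sum>p\<in>?B. T (I \<circ> p))"
      by (rule sum.reindex_bij_betw)
    then show "T' (I \<circ> q) = T' I" by (simp add: T'_def o_assoc)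
  qed
  fix x
  have *: "(\<Sum>I\<in>UNIV. T (I \<circ> p) * (\<Prod>k\<in>UNIV. x $ I k)) = tensor_form T x" if "bij p" for p :: "6 \<Rightarrow> 6"
    using sum_comp_bij[OF that, of "\<lambda>I. T I * (\<Prod>k\<in>UNIV. x $ I k)"] prod_bij_UNIV[OF that, of "\<lambda>k. x $ I k" for I]
    by (simp add: tensor_form_def)
  have "tensor_form T' x = (\<Sum>p\<in>?B. \<Sum>I\<in>UNIV. T (I \<circ> p) * (\<Prod>k\<in>UNIV. x $ I k)) / card ?B"
    by (subst sum.swap) (simp add: tensor_form_def T'_def sum_distrib_right sum_divide_distrib)
  then show "tensor_form T' x = tensor_form T x" using B \<open>id \<in> ?B\<close> by (auto simp: *)
qed

lemma multi_pullback: "multi (pullback A T) v = multi T (\<lambda>k. A *v v k)"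
proof -
  have "multi (pullback A T) v = (\<Sum>I\<in>UNIV. \<Sum>J\<in>UNIV. T J * (\<Prod>k\<in>UNIV. A $ J k $ I k * v k $ I k))"
    by (simp add: multi_def pullback_def sum_distrib_right prod.distrib mult.assoc)
  also have "\<dots> = (\<Sum>J\<in>UNIV. T J * (\<Sum>I\<in>UNIV. \<Prod>k\<in>UNIV. A $ J k $ I k * v k $ I k))"
    by (subst sum.swap) (simp add: sum_distrib_left)
  also have "\<dots> = multi T (\<lambda>k. A *v v k)"
    by (simp add: multi_def matrix_vector_mult_def prod_sum_PiE PiE_def Pi_def)
  finally show ?thesis .
qed

lemma tensor_form_pullback: "tensor_form (pullback A T) x = tensor_form T (A *v x)"
  by (simp add: tensor_form_multi multi_pullback)

lemma symmetric_tensor_pullback: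
  assumes "symmetric_tensor T"
  shows "symmetric_tensor (pullback A T)"
  unfolding symmetric_tensor_def
proof (intro allI impI)
  fix p :: "6 \<Rightarrow> 6" and I :: "6 \<Rightarrow> 8" assume p: "bij p"
  have "pullback A T (I \<circ> p) = (\<Sum>J\<in>UNIV. T (J \<circ> p) * (\<Prod>k\<in>UNIV. A $ (J \<circ> p) k $ I (p k)))"
    using sum_comp_bij[OF p, of "\<lambda>J. T J * (\<Prod>k\<in>UNIV. A $ J k $ I (p k))"] by (simp add: pullback_def)
  also have "\<dots> = pullback A T I"
    using assms p prod_bij_UNIV[OF p, of "\<lambda>k. A $ J k $ I k" for J]
    by (simp add: symmetric_tensor_def pullback_def)
  finally show "pullback A T (I \<circ> p) = pullback A T I" .
qed

text \<open>Homogeneous polynomials of degree 6, represented by tensors that may lack symmetry, so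
  that sums and products of linear forms need no symmetrization.\<close>

definition sextic_form :: "(real^8 \<Rightarrow> real) \<Rightarrow> bool" where
  "sextic_form f \<longleftrightarrow> (\<exists>T. f = tensor_form T)"

lemma sextic_form_add: "sextic_form f \<Longrightarrow> sextic_form g \<Longrightarrow> sextic_form (\<lambda>x. f x + g x)"
  unfolding sextic_form_def
proof (elim exE)
  fix T T' assume "f = tensor_form T" "g = tensor_form T'"
  then have "(\<lambda>x. f x + g x) = tensor_form (\<lambda>I. T I + T' I)"
    by (simp add: fun_eq_iff tensor_form_def distrib_right sum.distrib)
  then show "\<exists>T. (\<lambda>x. f x + g x) = tensor_form T" by blast
qed

lemma sextic_form_cmult: "sextic_form f \<Longrightarrow> sextic_form (\<lambda>x. c * f x)"
  unfolding sextic_form_def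
proof (elim exE)
  fix T assume "f = tensor_form T"
  then have "(\<lambda>x. c * f x) = tensor_form (\<lambda>I. c * T I)"
    by (simp add: fun_eq_iff tensor_form_def sum_distrib_left mult.assoc)
  then show "\<exists>T. (\<lambda>x. c * f x) = tensor_form T" by blast
qed

lemma sextic_form_sum:
  assumes "\<And>i. i \<in> A \<Longrightarrow> sextic_form (f i)"
  shows "sextic_form (\<lambda>x. \<Sum>i\<in>A. f i x)"
  using assms
proof (induction A rule: infinite_finite_induct)
  case (insert i A)
  then show ?case by (simp add: sextic_form_add)
qed (use sextic_form_cmult[of "tensor_form (\<lambda>_. 0)" 0] in \<open>auto simp: sextic_form_def\<close>)

lemma UNIV_6: "UNIV = {1::6, 2, 3, 4, 5, 6}"
proof -
  have "(x::6) = 1 \<or> x = 2 \<or> x = 3 \<or> x = 4 \<or> x = 5 \<or> x = 6" for x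
  proof (induct x)
    case (of_int z)
    then have "0 \<le> z" "z < 6" by simp_all
    then have "z = 0 \<or> z = 1 \<or> z = 2 \<or> z = 3 \<or> z = 4 \<or> z = 5" by arith
    then show ?case by auto
  qed
  then show ?thesis by auto
qed

text \<open>The tensor is the pure tensor of the six coefficient vectors. The bracketing anticipates
  the product of three quadratic forms.\<close>

lemma sextic_form_linear_factors:
  "sextic_form (\<lambda>x. ((a \<bullet> x) * (b \<bullet> x)) * (((c \<bullet> x) * (d \<bullet> x)) * ((e \<bullet> x) * (f \<bullet> x))))"
  unfolding sextic_form_def
proof (intro exI ext)
  fix x :: "real^8"
  let ?v = "vector [a, b, c, d, e, f] :: (real^8)^6"
  have v: "?v $ 1 = a" "?v $ 2 = b" "?v $ 3 = c" "?v $ 4 = d" "?v $ 5 = e" "?v $ 6 = f"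
    by (simp_all add: vector_def)
  have "((a \<bullet> x) * (b \<bullet> x)) * (((c \<bullet> x) * (d \<bullet> x)) * ((e \<bullet> x) * (f \<bullet> x))) = (\<Prod>k\<in>UNIV. ?v $ k \<bullet> x)"
    unfolding UNIV_6 by (simp add: v)
  also have "\<dots> = (\<Prod>k\<in>UNIV. \<Sum>i\<in>UNIV. ?v $ k $ i * x $ i)"
    by (simp add: inner_vec_def)
  also have "\<dots> = tensor_form (\<lambda>I. \<Prod>k\<in>UNIV. ?v $ k $ I k) x"
    by (simp add: tensor_form_def prod_sum_PiE PiE_def Pi_def flip: prod.distrib)
  finally show "((a \<bullet> x) * (b \<bullet> x)) * (((c \<bullet> x) * (d \<bullet> x)) * ((e \<bullet> x) * (f \<bullet> x))) = \<dots>" .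
qed

lemma sextic_form_quadratic_factors:
  "sextic_form (\<lambda>x. (\<Sum>i\<in>A. (a i \<bullet> x) * (b i \<bullet> x)) *
     ((\<Sum>i\<in>B. (c i \<bullet> x) * (d i \<bullet> x)) * (\<Sum>i\<in>C. (e i \<bullet> x) * (f i \<bullet> x))))"
proof -
  have "(\<Sum>i\<in>A. (a i \<bullet> x) * (b i \<bullet> x)) *
     ((\<Sum>i\<in>B. (c i \<bullet> x) * (d i \<bullet> x)) * (\<Sum>i\<in>C. (e i \<bullet> x) * (f i \<bullet> x))) =
     (\<Sum>k\<in>C. \<Sum>j\<in>B. \<Sum>i\<in>A. ((a i \<bullet> x) * (b i \<bullet> x)) *
       (((c j \<bullet> x) * (d j \<bullet> x)) * ((e k \<bullet> x) * (f k \<bullet> x))))" for x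
    by (simp only: sum_distrib_left sum_distrib_right)
  then show ?thesis
    by (simp only:) (intro sextic_form_sum sextic_form_linear_factors)
qed

lemma prod_3: "prod f (UNIV::3 set) = f 1 * f 2 * f 3"
  unfolding UNIV_3 by (simp add: ac_simps)

lemma sextic_form_F:
  "sextic_form (\<lambda>x. (x \<bullet> x) ^ 3 - det (alpha x ** transpose (alpha x)) / 2)"
proof -
  have sq: "(\<Sum>i\<in>UNIV. (axis i 1 \<bullet> x) * (axis i 1 \<bullet> x)) = x \<bullet> x" for x :: "real^8"
    by (simp add: inner_axis') (simp add: inner_vec_def)
  have "sextic_form (\<lambda>x. (x \<bullet> x) ^ 3)"
    using sextic_form_quadratic_factors[of "\<lambda>i. axis i 1" "\<lambda>i. axis i 1" UNIV
        "\<lambda>i. axis i 1" "\<lambda>i. axis i 1" UNIV "\<lambda>i. axis i 1" "\<lambda>i. axis i 1" UNIV]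
    unfolding sq power3_eq_cube mult.assoc .
  moreover have "sextic_form (\<lambda>x. - 1/2 * det (alpha x ** transpose (alpha x)))"
  proof (rule sextic_form_cmult)
    \<comment> \<open>\<open>l i k\<close> represents the entry (i, k) of \<open>alpha x\<close> as
      a linear functional of x, so each entry of the Gram matrix is a sum of products of two
      functionals.\<close>
    define l where "l = (\<lambda>i k. (\<chi> j. alpha (axis j 1) $ i $ k) :: real^8)"
    have l: "alpha x $ i $ k = l i k \<bullet> x" for x i k
    proof -
      have "alpha x = alpha (\<Sum>j\<in>UNIV. x $ j *\<^sub>R axis j 1)"
        by (simp add: basis_expansion flip: scalar_mult_eq_scaleR)
      also have "\<dots> = (\<Sum>j\<in>UNIV. x $ j *\<^sub>R alpha (axis j 1))"
        by (simp add: linear_sum[OF linear_alpha] linear_scale[OF linear_alpha])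
      finally show ?thesis by (simp add: l_def inner_vec_def mult.commute)
    qed
    show "sextic_form (\<lambda>x. det (alpha x ** transpose (alpha x)))"
      unfolding det_def
    proof (intro sextic_form_sum sextic_form_cmult)
      fix p :: "3 \<Rightarrow> 3"
      have "(\<Prod>i\<in>UNIV. (alpha x ** transpose (alpha x)) $ i $ p i) =
        (\<Sum>k\<in>UNIV. (l 1 k \<bullet> x) * (l (p 1) k \<bullet> x)) *
        ((\<Sum>k\<in>UNIV. (l 2 k \<bullet> x) * (l (p 2) k \<bullet> x)) * (\<Sum>k\<in>UNIV. (l 3 k \<bullet> x) * (l (p 3) k \<bullet> x)))" for x
        by (simp only: prod_3 matrix_matrix_mult_def transpose_def vec_lambda_beta l mult.assoc)
      then show "sextic_form (\<lambda>x. \<Prod>i\<in>UNIV. (alpha x ** transpose (alpha x)) $ i $ p i)"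
        by (simp only: sextic_form_quadratic_factors)
    qed
  qed
  ultimately show ?thesis
    using sextic_form_add[of "\<lambda>x. (x \<bullet> x) ^ 3" "\<lambda>x. - 1/2 * det (alpha x ** transpose (alpha x))"] by simp
qed

section \<open>Quaternions acting on the 8-dimensional space\<close>

text \<open>
  Quaternions are coordinate vectors with real part \<open>$ 1\<close>.  \<open>QL\<close>, \<open>QR\<close> extend \<open>2 s\<^sub>i\<close> and the lower blocks of
  \<open>2 \<sigma>\<^sub>i\<close>; \<open>R3\<close> is the rotation formula left homogeneous of degree 2 and \<open>r3\<close> its linearization at 1, so that
  the identities below hold for all quaternions, without normalization.
\<close>

definition qmul :: "real^4 \<Rightarrow> real^4 \<Rightarrow> real^4" where
  "qmul p q = vector
    [p$1 * q$1 - p$2 * q$2 - p$3 * q$3 - p$4 * q$4,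
     p$1 * q$2 + p$2 * q$1 + p$3 * q$4 - p$4 * q$3,
     p$1 * q$3 - p$2 * q$4 + p$3 * q$1 + p$4 * q$2,
     p$1 * q$4 + p$2 * q$3 - p$3 * q$2 + p$4 * q$1]"

definition QL :: "real^4 \<Rightarrow> real^4^4" where
  "QL q = vector
    [vector [q$1, q$2, q$3, q$4],
     vector [- q$2, q$1, - q$4, q$3],
     vector [- q$3, q$4, q$1, - q$2],
     vector [- q$4, - q$3, q$2, q$1]]"

definition QR :: "real^4 \<Rightarrow> real^4^4" where
  "QR q = vector
    [vector [q$1, - q$4, q$3, - q$2],
     vector [q$4, q$1, - q$2, - q$3],
     vector [- q$3, q$2, q$1, - q$4],
     vector [q$2, q$3, q$4, q$1]]"

definition R3 :: "real^4 \<Rightarrow> real^3^3" where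
  "R3 q = vector
    [vector [(q$1)\<^sup>2 + (q$4)\<^sup>2 - (q$2)\<^sup>2 - (q$3)\<^sup>2, - 2 * q$1 * q$2 - 2 * q$3 * q$4, 2 * q$1 * q$3 - 2 * q$2 * q$4],
     vector [2 * q$1 * q$2 - 2 * q$3 * q$4, (q$1)\<^sup>2 + (q$3)\<^sup>2 - (q$2)\<^sup>2 - (q$4)\<^sup>2, 2 * q$1 * q$4 + 2 * q$2 * q$3],
     vector [- 2 * q$1 * q$3 - 2 * q$2 * q$4, - 2 * q$1 * q$4 + 2 * q$2 * q$3, (q$1)\<^sup>2 + (q$2)\<^sup>2 - (q$3)\<^sup>2 - (q$4)\<^sup>2]]"

definition r3 :: "real^4 \<Rightarrow> real^3^3" where
  "r3 q = vector
    [vector [0, - 2 * q$2, 2 * q$3],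
     vector [2 * q$2, 0, 2 * q$4],
     vector [- 2 * q$3, - 2 * q$4, 0]]"

definition qconj :: "real^4 \<Rightarrow> real^4" where
  "qconj q = vector [q$1, - q$2, - q$3, - q$4]"

definition qone :: "real^4" where
  "qone = vector [1, 0, 0, 0]"

lemmas mat_simps = vec_eq_iff forall_3 forall_4 matrix_matrix_mult_def sum_3 sum_4 transpose_def mat_def

lemma QL_mult: "QL p ** QL q = QL (qmul p q)"
  by (simp add: mat_simps QL_def qmul_def algebra_simps)

lemma QR_mult: "QR p ** QR q = QR (qmul p q)"
  by (simp add: mat_simps QR_def qmul_def algebra_simps)

lemma QL_QR_commute: "QL p ** QR q = QR q ** QL p"
  by (simp add: mat_simps QL_def QR_def algebra_simps)

lemma R3_mult: "R3 p ** R3 q = R3 (qmul p q)"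
  by (simp add: mat_simps R3_def qmul_def power2_eq_square algebra_simps)

lemma qone_simps [simp]: "qmul qone q = q" "qmul q qone = q"
  by (simp_all add: mat_simps qmul_def qone_def)

lemma QL_one: "QL qone = mat 1" and QR_one: "QR qone = mat 1" and R3_one: "R3 qone = mat 1"
  by (simp_all add: mat_simps QL_def QR_def R3_def qone_def)

lemma transpose_QL: "transpose (QL q) = QL (qconj q)"
  and transpose_QR: "transpose (QR q) = QR (qconj q)"
  and transpose_R3: "transpose (R3 q) = R3 (qconj q)"
  by (simp_all add: mat_simps QL_def QR_def R3_def qconj_def)

lemma qmul_assoc: "qmul (qmul p q) r = qmul p (qmul q r)"
  by (simp add: mat_simps qmul_def algebra_simps)

lemma qmul_qconj: "qmul q (qconj q) = (q \<bullet> q) *\<^sub>R qone" "qmul (qconj q) q = (q \<bullet> q) *\<^sub>R qone"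
  by (simp_all add: mat_simps qmul_def qone_def qconj_def inner_vec_def)

lemma inner_qmul: "qmul p q \<bullet> qmul p q = (p \<bullet> p) * (q \<bullet> q)"
  by (simp add: inner_vec_def sum_4 qmul_def algebra_simps)

text \<open>\<open>R3\<close> is quadratic and \<open>r3 q\<close> is its polarization against
  \<open>qone\<close>; this lets relations for \<open>r3\<close> be derived from the
  multiplicativity of \<open>R3\<close>.\<close>

lemma R3_polarize: "R3 (qone + q) = R3 qone + r3 q + R3 q" if "q $ 1 = 0"
  using that by (simp add: mat_simps R3_def r3_def qone_def power2_eq_square algebra_simps)

lemma alpha_space_QL: "alpha x ** transpose (QL q) \<in> alpha_space"
  by (simp add: alpha_space_def mat_simps QL_def alpha_def algebra_simps)

lemma alpha_space_QR: "R3 q ** alpha x ** transpose (QR q) \<in> alpha_space"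
  by (simp add: alpha_space_def mat_simps QR_def R3_def alpha_def power2_eq_square algebra_simps)

lemma alpha_space_r3: "q $ 1 = 0 \<Longrightarrow> r3 q ** alpha x + alpha x ** transpose (QR q) \<in> alpha_space"
  by (simp add: alpha_space_def mat_simps QR_def r3_def alpha_def algebra_simps)

section \<open>The group action and its generators in coordinates\<close>

definition gact :: "real^4 \<Rightarrow> real^4 \<Rightarrow> real^8 \<Rightarrow> real^8" where
  "gact p q x = proj8 (R3 q ** alpha x ** transpose (QL p ** QR q))"

text \<open>\<open>QL\<close> is linear, so the same operator serves as the group element p for unit
  p and as the generator p for imaginary p.\<close>

definition opS :: "real^4 \<Rightarrow> real^8 \<Rightarrow> real^8" where
  "opS p x = proj8 (alpha x ** transpose (QL p))"

text \<open>For imaginary q, the derivative of \<open>gact qone\<close> at \<open>qone\<close> in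
  the direction q.\<close>

definition opT :: "real^4 \<Rightarrow> real^8 \<Rightarrow> real^8" where
  "opT q x = proj8 (r3 q ** alpha x + alpha x ** transpose (QR q))"

lemma alpha_opS: "alpha (opS p x) = alpha x ** transpose (QL p)"
  by (simp add: opS_def alpha_proj8 alpha_space_QL)

lemma alpha_opT: "q $ 1 = 0 \<Longrightarrow> alpha (opT q x) = r3 q ** alpha x + alpha x ** transpose (QR q)"
  by (simp add: opT_def alpha_proj8 alpha_space_r3)

lemma alpha_gact: "alpha (gact p q x) = R3 q ** alpha x ** transpose (QL p ** QR q)"
proof -
  \<comment> \<open>The two factors are applied one after the other, since each of them preserves
    \<open>alpha_space\<close>.\<close>
  have "R3 q ** alpha x ** transpose (QL p ** QR q) = alpha (opS p (proj8 (R3 q ** alpha x ** transpose (QR q))))"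
    by (simp add: alpha_opS alpha_proj8 alpha_space_QR matrix_transpose_mul matrix_mul_assoc)
  then show ?thesis by (simp add: gact_def proj8_alpha)
qed

lemma matrix_add_distrib_right: "(A + B) ** C = A ** C + B ** (C :: 'a::semiring_1^'n^'m)"
  by (simp add: vec_eq_iff matrix_matrix_mult_def distrib_right sum.distrib)

lemma linear_gact: "linear (gact p q)"
  by (rule linearI) (simp_all add: inj_alpha[symmetric] alpha_gact linear_add[OF linear_alpha] linear_scale[OF linear_alpha]
      matrix_add_ldistrib matrix_add_distrib_right  scalar_matrix_assoc matrix_scalar_ac)

lemma linear_opS: "linear (opS p)"
  by (rule linearI) (simp_all add: inj_alpha[symmetric] alpha_opS linear_add[OF linear_alpha] linear_scale[OF linear_alpha]
      matrix_add_ldistrib matrix_add_distrib_right scalar_matrix_assoc matrix_scalar_ac)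

lemma linear_opT: "linear (opT q)"
proof -
  have "linear (\<lambda>x. r3 q ** alpha x + alpha x ** transpose (QR q))"
    by (rule linearI) (simp_all add: linear_add[OF linear_alpha] linear_scale[OF linear_alpha]
      matrix_add_ldistrib matrix_add_distrib_right scalar_matrix_assoc matrix_scalar_ac scaleR_right_distrib)
  from linear_compose[OF this linear_proj8] show ?thesis by (simp add: o_def opT_def[abs_def])
qed

section \<open>The derivative of F\<close>

definition det3_deriv :: "real^3^3 \<Rightarrow> real^3^3 \<Rightarrow> real" where
  "det3_deriv S D =
      D$1$1 * (S$2$2 * S$3$3 - S$2$3 * S$3$2) - D$1$2 * (S$2$1 * S$3$3 - S$2$3 * S$3$1) + D$1$3 * (S$2$1 * S$3$2 - S$2$2 * S$3$1) -
      D$2$1 * (S$1$2 * S$3$3 - S$1$3 * S$3$2) + D$2$2 * (S$1$1 * S$3$3 - S$1$3 * S$3$1) - D$2$3 * (S$1$1 * S$3$2 - S$1$2 * S$3$1) +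
      D$3$1 * (S$1$2 * S$2$3 - S$1$3 * S$2$2) - D$3$2 * (S$1$1 * S$2$3 - S$1$3 * S$2$1) + D$3$3 * (S$1$1 * S$2$2 - S$1$2 * S$2$1)"

text \<open>The Gram matrix is quadratic along a line, hence the term with C, which does not affect
  the derivative at 0.\<close>

lemma DERIV_det3:
  "((\<lambda>t. det (S + t *\<^sub>R D + t\<^sup>2 *\<^sub>R C)) has_real_derivative det3_deriv S D) (at 0)"
  unfolding det_3 det3_deriv_def by (auto intro!: derivative_eq_intros simp: algebra_simps)

definition gram_deriv :: "real^8 \<Rightarrow> real^8 \<Rightarrow> real^3^3" where
  "gram_deriv x v = alpha x ** transpose (alpha v) + alpha v ** transpose (alpha x)"

definition dF :: "real^8 \<Rightarrow> real^8 \<Rightarrow> real" where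
  "dF x v = 6 * (x \<bullet> x)\<^sup>2 * (x \<bullet> v) - det3_deriv (gram x) (gram_deriv x v) / 2"

lemma DERIV_F: "((\<lambda>t. F (x + t *\<^sub>R v)) has_real_derivative dF x v) (at 0)"
proof -
  have "gram (x + t *\<^sub>R v) = gram x + t *\<^sub>R gram_deriv x v + t\<^sup>2 *\<^sub>R gram v" for t
    by (simp add: gram_def gram_deriv_def linear_add[OF linear_alpha] linear_scale[OF linear_alpha] mat_simps
        power2_eq_square algebra_simps)
  moreover have "(x + t *\<^sub>R v) \<bullet> (x + t *\<^sub>R v) = x \<bullet> x + 2 * t * (x \<bullet> v) + t\<^sup>2 * (v \<bullet> v)" for t
    by (simp add: inner_simps inner_commute power2_eq_square algebra_simps)
  ultimately show ?thesis
    unfolding F_eq dF_def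
    by (auto intro!: derivative_eq_intros DERIV_det3[unfolded power2_eq_square] simp: power2_eq_square)
qed

text \<open>Ties the metric to the Gram matrix, so that a generator that preserves the trace of the
  Gram matrix infinitesimally is orthogonal to x.\<close>

lemma trace_gram_deriv: "trace (gram_deriv x v) = 12 * (x \<bullet> v)"
  using sum_squares_alpha[of x v] by (simp add: trace_def gram_deriv_def mat_simps algebra_simps)

lemma qconj_imag: "q $ 1 = 0 \<Longrightarrow> qconj q = - q"
  by (simp add: qconj_def mat_simps)

lemma QL_minus: "QL (- q) = - QL q" and QR_minus: "QR (- q) = - QR q"
  by (simp_all add: QL_def QR_def mat_simps)

lemma transpose_r3: "transpose (r3 q) = - r3 q"
  by (simp add: r3_def mat_simps)

lemma matrix_mul_minus: "A ** - B = - (A ** (B :: 'a::ring_1^'n^'m))" "- A ** B = - (A ** B)"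
  by (simp_all add: matrix_matrix_mult_def vec_eq_iff sum_negf)

lemma transpose_add: "transpose (A + B) = transpose A + transpose (B :: 'a::ring_1^'n^'m)"
  and transpose_minus: "transpose (- A) = - transpose (A :: 'a::ring_1^'n^'m)"
  by (simp_all add: transpose_def vec_eq_iff)

lemma matrix_diff_distrib: "A ** (B - C) = A ** B - A ** (C :: 'a::ring_1^'n^'m)"
    "(D - E) ** C = D ** C - E ** C"
  by (simp_all add: matrix_matrix_mult_def vec_eq_iff algebra_simps sum_subtractf)

lemma transpose_diff: "transpose (A - B) = transpose A - transpose (B :: 'a::ring_1^'n^'m)"
  by (simp add: transpose_def vec_eq_iff)

text \<open>The first factor multiplies \<open>alpha x\<close> from the right, and for imaginary p
  this is by an antisymmetric matrix, so the two terms cancel.\<close>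

lemma gram_deriv_opS:
  "p $ 1 = 0 \<Longrightarrow> gram_deriv x (opS p x) = 0"
  by (simp add: gram_deriv_def alpha_opS matrix_transpose_mul matrix_mul_assoc transpose_QL qconj_imag QL_minus matrix_mul_minus transpose_minus)

text \<open>The second factor conjugates the Gram matrix by rotations, whose derivative is a
  commutator; its antisymmetric right factor cancels as above.\<close>

lemma gram_deriv_opT:
  "p $ 1 = 0 \<Longrightarrow> gram_deriv x (opT p x) = r3 p ** gram x - gram x ** r3 p"
  by (simp add: gram_deriv_def gram_def alpha_opT matrix_transpose_mul matrix_mul_assoc transpose_QR qconj_imag QR_minus
        matrix_mul_minus transpose_r3 matrix_diff_distrib transpose_diff transpose_minus)

lemma inner_opS: "p $ 1 = 0 \<Longrightarrow> x \<bullet> opS p x = 0"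
  using trace_gram_deriv[of x "opS p x"] by (simp add: gram_deriv_opS trace_def)

lemma inner_opT: "p $ 1 = 0 \<Longrightarrow> x \<bullet> opT p x = 0"
proof -
  assume p: "p $ 1 = 0"
  have "trace (gram_deriv x (opT p x)) = 0"
    unfolding gram_deriv_opT[OF p] trace_sub by (subst trace_mul_sym) simp
  then show ?thesis by (simp add: trace_gram_deriv)
qed

lemma dF_opS: "p $ 1 = 0 \<Longrightarrow> dF x (opS p x) = 0"
  by (simp add: dF_def inner_opS gram_deriv_opS) (simp add: det3_deriv_def)

text \<open>Conjugation by rotations preserves the determinant; this is the infinitesimal version at
  a symmetric matrix.\<close>

lemma det3_deriv_commutator:
  assumes "S $ 2 $ 1 = S $ 1 $ 2" "S $ 3 $ 1 = S $ 1 $ 3" "S $ 3 $ 2 = S $ 2 $ 3"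
  shows "det3_deriv S (r3 p ** S - S ** r3 p) = 0"
  using assms by (simp add: det3_deriv_def matrix_matrix_mult_def sum_3 r3_def) (simp add: algebra_simps)

lemma dF_opT:
  assumes "p $ 1 = 0"
  shows "dF x (opT p x) = 0"
proof -
  have "gram x $ 2 $ 1 = gram x $ 1 $ 2" "gram x $ 3 $ 1 = gram x $ 1 $ 3" "gram x $ 3 $ 2 = gram x $ 2 $ 3"
    by (simp_all add: gram_def mat_simps mult.commute)
  then have "det3_deriv (gram x) (gram_deriv x (opT p x)) = 0"
    unfolding gram_deriv_opT[OF assms] by (rule det3_deriv_commutator)
  then show ?thesis by (simp add: dF_def inner_opT[OF assms])
qed

section \<open>The Lie algebra annihilating the sextic form\<close>

text \<open>Rescaling the even coordinates by \<open>sqrt 3\<close> makes \<open>alpha\<close> integral.\<close>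

definition scl :: "real^8 \<Rightarrow> real^8" where
  "scl u = vector [u$1, sqrt 3 * u$2, u$3, sqrt 3 * u$4, u$5, sqrt 3 * u$6, u$7, sqrt 3 * u$8]"

lemma alpha_scl: "alpha (scl u) = vector
    [vector [- u$3 + 3 * u$4, - u$5 + 3 * u$6, - u$7 + 3 * u$8, - 2 * u$1],
     vector [- u$1 - 3 * u$2, u$7 + 3 * u$8, - u$5 - 3 * u$6, 2 * u$3],
     vector [- 2 * u$7, u$1 - 3 * u$2, - u$3 - 3 * u$4, - 2 * u$5]]"
  by (simp add: mat_simps alpha_def scl_def sqrt3_sqrt3)

lemma inner_scl: "scl u \<bullet> scl v = u$1 * v$1 + 3 * (u$2 * v$2) + u$3 * v$3 + 3 * (u$4 * v$4) +
    u$5 * v$5 + 3 * (u$6 * v$6) + u$7 * v$7 + 3 * (u$8 * v$8)"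
  by (simp add: inner_vec_def sum_8 scl_def sqrt3_sqrt3 algebra_simps)

lemma alpha_scl_nth:
  "alpha (scl u) $ 1 $ 1 = 3 * u$4 - u$3" "alpha (scl u) $ 1 $ 2 = 3 * u$6 - u$5"
  "alpha (scl u) $ 1 $ 3 = 3 * u$8 - u$7" "alpha (scl u) $ 1 $ 4 = - 2 * u$1"
  "alpha (scl u) $ 2 $ 1 = - u$1 - 3 * u$2" "alpha (scl u) $ 2 $ 2 = u$7 + 3 * u$8"
  "alpha (scl u) $ 2 $ 3 = - u$5 - 3 * u$6" "alpha (scl u) $ 2 $ 4 = 2 * u$3"
  "alpha (scl u) $ 3 $ 1 = - 2 * u$7" "alpha (scl u) $ 3 $ 2 = u$1 - 3 * u$2"
  "alpha (scl u) $ 3 $ 3 = - u$3 - 3 * u$4" "alpha (scl u) $ 3 $ 4 = - 2 * u$5"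
  by (simp_all add: alpha_scl)

lemma gram_scl: "gram (scl u) $ i $ j = (\<Sum>k\<in>UNIV. alpha (scl u) $ i $ k * alpha (scl u) $ j $ k)"
  by (simp add: gram_def matrix_matrix_mult_def transpose_def)

lemma gram_deriv_scl: "gram_deriv (scl u) (scl v) $ i $ j =
   (\<Sum>k\<in>UNIV. alpha (scl u) $ i $ k * alpha (scl v) $ j $ k + alpha (scl v) $ i $ k * alpha (scl u) $ j $ k)"
  by (simp add: gram_deriv_def matrix_matrix_mult_def transpose_def sum.distrib)

lemmas dF_eval = dF_def det3_deriv_def gram_scl gram_deriv_scl sum_4 inner_scl alpha_scl_nth
lemmas mult_vec_eval = matrix_vector_mult_def sum_8

text \<open>The matrix of \<open>opS v + opT w\<close> in the rescaled coordinates.\<close>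

definition lie_mat :: "real^4 \<Rightarrow> real^4 \<Rightarrow> real^8^8" where
  "lie_mat v w = vector
    [vector [0, 0, (- v$4 + 5 * w$2)/2, (3 * v$4 - 3 * w$2)/2, (- v$3 + 5 * w$3)/2, (3 * v$3 - 3 * w$3)/2, (v$2 + w$4)/2, (- 3 * v$2 - 3 * w$4)/2],
     vector [0, 0, (- v$4 + w$2)/2, (- v$4 - 3 * w$2)/2, (v$3 - w$3)/2, (v$3 + 3 * w$3)/2, (- v$2 + 3 * w$4)/2, (- v$2 + 3 * w$4)/2],
     vector [(v$4 - 5 * w$2)/2, (3 * v$4 - 3 * w$2)/2, 0, 0, (- v$2 - 5 * w$4)/2, (- 3 * v$2 - 3 * w$4)/2, (- v$3 + w$3)/2, (- 3 * v$3 + 3 * w$3)/2],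
     vector [(- v$4 + w$2)/2, (v$4 + 3 * w$2)/2, 0, 0, (- v$2 - w$4)/2, (v$2 - 3 * w$4)/2, (- v$3 - 3 * w$3)/2, (v$3 + 3 * w$3)/2],
     vector [(v$3 - 5 * w$3)/2, (- 3 * v$3 + 3 * w$3)/2, (v$2 + 5 * w$4)/2, (3 * v$2 + 3 * w$4)/2, 0, 0, - v$4 + w$2, 0],
     vector [(- v$3 + w$3)/2, (- v$3 - 3 * w$3)/2, (v$2 + w$4)/2, (- v$2 + 3 * w$4)/2, 0, 0, 0, - v$4 - 3 * w$2],
     vector [(- v$2 - w$4)/2, (3 * v$2 - 9 * w$4)/2, (v$3 - w$3)/2, (3 * v$3 + 9 * w$3)/2, v$4 - w$2, 0, 0, 0],
     vector [(v$2 + w$4)/2, (v$2 - 3 * w$4)/2, (v$3 - w$3)/2, (- v$3 - 3 * w$3)/2, 0, v$4 + 3 * w$2, 0, 0]]"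

text \<open>
  \<open>B\<close> splits into \<open>2 \<times> 2\<close> blocks, and points supported on one, two or three pairs of coordinates only see the
  corresponding blocks.  The sample points were found by computer search.
\<close>

context
  fixes B :: "real^8^8"
  assumes H: "\<And>u. dF (scl u) (scl (B *v u)) = 0"
begin

lemma lie_diag:
  shows "B$1$1 = 0" "B$1$2 = 0" "B$2$1 = 0" "B$2$2 = 0" "B$3$3 = 0" "B$3$4 = 0" "B$4$3 = 0" "B$4$4 = 0" "B$5$5 = 0"
    "B$5$6 = 0" "B$6$5 = 0" "B$6$6 = 0" "B$7$7 = 0" "B$7$8 = 0" "B$8$7 = 0" "B$8$8 = 0"
proof -
  \<comment> \<open>Each point gives one linear equation in the entries of B. \<open>dF\<close> is
    expanded while \<open>B *v u\<close> is still atomic, so that components with vanishing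
    coefficient disappear before the matrix product is expanded.\<close>
  note e00 = H[of "vector [0, 1, 0, 0, 0, 0, 0, 0]", simplified dF_eval, simplified, simplified mult_vec_eval, simplified]
  note e01 = H[of "vector [1, 0, 0, 0, 0, 0, 0, 0]", simplified dF_eval, simplified, simplified mult_vec_eval, simplified]
  note e02 = H[of "vector [1, 1, 0, 0, 0, 0, 0, 0]", simplified dF_eval, simplified, simplified mult_vec_eval, simplified]
  note e03 = H[of "vector [1, 2, 0, 0, 0, 0, 0, 0]", simplified dF_eval, simplified, simplified mult_vec_eval, simplified]
  note e10 = H[of "vector [0, 0, 0, 1, 0, 0, 0, 0]", simplified dF_eval, simplified, simplified mult_vec_eval, simplified]
  note e11 = H[of "vector [0, 0, 1, 0, 0, 0, 0, 0]", simplified dF_eval, simplified, simplified mult_vec_eval, simplified]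
  note e12 = H[of "vector [0, 0, 1, 1, 0, 0, 0, 0]", simplified dF_eval, simplified, simplified mult_vec_eval, simplified]
  note e13 = H[of "vector [0, 0, 1, 2, 0, 0, 0, 0]", simplified dF_eval, simplified, simplified mult_vec_eval, simplified]
  note e20 = H[of "vector [0, 0, 0, 0, 0, 1, 0, 0]", simplified dF_eval, simplified, simplified mult_vec_eval, simplified]
  note e21 = H[of "vector [0, 0, 0, 0, 1, 0, 0, 0]", simplified dF_eval, simplified, simplified mult_vec_eval, simplified]
  note e22 = H[of "vector [0, 0, 0, 0, 1, 1, 0, 0]", simplified dF_eval, simplified, simplified mult_vec_eval, simplified]
  note e23 = H[of "vector [0, 0, 0, 0, 1, 2, 0, 0]", simplified dF_eval, simplified, simplified mult_vec_eval, simplified]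
  note e30 = H[of "vector [0, 0, 0, 0, 0, 0, 0, 1]", simplified dF_eval, simplified, simplified mult_vec_eval, simplified]
  note e31 = H[of "vector [0, 0, 0, 0, 0, 0, 1, 0]", simplified dF_eval, simplified, simplified mult_vec_eval, simplified]
  note e32 = H[of "vector [0, 0, 0, 0, 0, 0, 1, 1]", simplified dF_eval, simplified, simplified mult_vec_eval, simplified]
  note e33 = H[of "vector [0, 0, 0, 0, 0, 0, 1, 2]", simplified dF_eval, simplified, simplified mult_vec_eval, simplified]
  show "B$1$1 = 0" "B$1$2 = 0" "B$2$1 = 0" "B$2$2 = 0"
    using e00 e01 e02 e03 by linarith+
  show "B$3$3 = 0" "B$3$4 = 0" "B$4$3 = 0" "B$4$4 = 0"
    using e10 e11 e12 e13 by linarith+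
  show "B$5$5 = 0" "B$5$6 = 0" "B$6$5 = 0" "B$6$6 = 0"
    using e20 e21 e22 e23 by linarith+
  show "B$7$7 = 0" "B$7$8 = 0" "B$8$7 = 0" "B$8$8 = 0"
    using e30 e31 e32 e33 by linarith+
qed

text \<open>Six equations for the eight entries of the two blocks joining the first and second pair
  leave two parameters. The five lemmas that follow do the same for the other couples of
  pairs.\<close>

lemma lie_pair_12:
  shows "B$2$3 = - B$1$4/3" "B$2$4 = - B$1$3 - 2 * B$1$4/3" "B$3$1 = - B$1$3" "B$3$2 = B$1$4" "B$4$1 = - B$1$4/3"
    "B$4$2 = B$1$3 + 2 * B$1$4/3"
proof -
  note d = lie_diag
  note e1 = H[of "vector [0, 1, 0, 1, 0, 0, 0, 0]", simplified dF_eval, simplified, simplified mult_vec_eval, simplified, simplified d, simplified]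
  note e2 = H[of "vector [0, 1, 1, 0, 0, 0, 0, 0]", simplified dF_eval, simplified, simplified mult_vec_eval, simplified, simplified d, simplified]
  note e3 = H[of "vector [1, 0, 0, 1, 0, 0, 0, 0]", simplified dF_eval, simplified, simplified mult_vec_eval, simplified, simplified d, simplified]
  note e4 = H[of "vector [1, 0, 1, 0, 0, 0, 0, 0]", simplified dF_eval, simplified, simplified mult_vec_eval, simplified, simplified d, simplified]
  note e5 = H[of "vector [0, 1, 2, 0, 0, 0, 0, 0]", simplified dF_eval, simplified, simplified mult_vec_eval, simplified, simplified d, simplified]
  note e6 = H[of "vector [1, 0, 0, 2, 0, 0, 0, 0]", simplified dF_eval, simplified, simplified mult_vec_eval, simplified, simplified d, simplified]
  show "B$2$3 = - B$1$4/3" "B$2$4 = - B$1$3 - 2 * B$1$4/3" "B$3$1 = - B$1$3" "B$3$2 = B$1$4" "B$4$1 = - B$1$4/3"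
    "B$4$2 = B$1$3 + 2 * B$1$4/3"
    using e1 e2 e3 e4 e5 e6 by linarith+
qed

lemma lie_pair_13:
  shows "B$2$5 = B$1$6/3" "B$2$6 = B$1$5 + 2 * B$1$6/3" "B$5$1 = - B$1$5" "B$5$2 = - B$1$6" "B$6$1 = - B$1$6/3"
    "B$6$2 = - B$1$5 - 2 * B$1$6/3"
proof -
  note d = lie_diag
  note e1 = H[of "vector [0, 1, 0, 0, 0, 1, 0, 0]", simplified dF_eval, simplified, simplified mult_vec_eval, simplified, simplified d, simplified]
  note e2 = H[of "vector [0, 1, 0, 0, 1, 0, 0, 0]", simplified dF_eval, simplified, simplified mult_vec_eval, simplified, simplified d, simplified]
  note e3 = H[of "vector [1, 0, 0, 0, 0, 1, 0, 0]", simplified dF_eval, simplified, simplified mult_vec_eval, simplified, simplified d, simplified]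
  note e4 = H[of "vector [1, 0, 0, 0, 1, 0, 0, 0]", simplified dF_eval, simplified, simplified mult_vec_eval, simplified, simplified d, simplified]
  note e5 = H[of "vector [0, 1, 0, 0, 2, 0, 0, 0]", simplified dF_eval, simplified, simplified mult_vec_eval, simplified, simplified d, simplified]
  note e6 = H[of "vector [1, 0, 0, 0, 0, 2, 0, 0]", simplified dF_eval, simplified, simplified mult_vec_eval, simplified, simplified d, simplified]
  show "B$2$5 = B$1$6/3" "B$2$6 = B$1$5 + 2 * B$1$6/3" "B$5$1 = - B$1$5" "B$5$2 = - B$1$6" "B$6$1 = - B$1$6/3"
    "B$6$2 = - B$1$5 - 2 * B$1$6/3"
    using e1 e2 e3 e4 e5 e6 by linarith+
qed

lemma lie_pair_14:
  shows "B$1$8 = - 3 * B$1$7" "B$2$8 = B$2$7" "B$7$1 = - B$1$7" "B$7$2 = - 3 * B$2$7" "B$8$1 = B$1$7"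
    "B$8$2 = - B$2$7"
proof -
  note d = lie_diag
  note e1 = H[of "vector [0, 1, 0, 0, 0, 0, 0, 1]", simplified dF_eval, simplified, simplified mult_vec_eval, simplified, simplified d, simplified]
  note e2 = H[of "vector [0, 1, 0, 0, 0, 0, 1, 0]", simplified dF_eval, simplified, simplified mult_vec_eval, simplified, simplified d, simplified]
  note e3 = H[of "vector [1, 0, 0, 0, 0, 0, 0, 1]", simplified dF_eval, simplified, simplified mult_vec_eval, simplified, simplified d, simplified]
  note e4 = H[of "vector [1, 0, 0, 0, 0, 0, 1, 0]", simplified dF_eval, simplified, simplified mult_vec_eval, simplified, simplified d, simplified]
  note e5 = H[of "vector [0, 1, 0, 0, 0, 0, 0, 2]", simplified dF_eval, simplified, simplified mult_vec_eval, simplified, simplified d, simplified]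
  note e6 = H[of "vector [1, 0, 0, 0, 0, 0, 0, 2]", simplified dF_eval, simplified, simplified mult_vec_eval, simplified, simplified d, simplified]
  show "B$1$8 = - 3 * B$1$7" "B$2$8 = B$2$7" "B$7$1 = - B$1$7" "B$7$2 = - 3 * B$2$7" "B$8$1 = B$1$7" "B$8$2 = - B$2$7"
    using e1 e2 e3 e4 e5 e6 by linarith+
qed

lemma lie_pair_23:
  shows "B$4$5 = B$3$6/3" "B$4$6 = B$3$5 - 2 * B$3$6/3" "B$5$3 = - B$3$5" "B$5$4 = - B$3$6" "B$6$3 = - B$3$6/3"
    "B$6$4 = - B$3$5 + 2 * B$3$6/3"
proof -
  note d = lie_diag
  note e1 = H[of "vector [0, 0, 0, 1, 0, 1, 0, 0]", simplified dF_eval, simplified, simplified mult_vec_eval, simplified, simplified d, simplified]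
  note e2 = H[of "vector [0, 0, 0, 1, 1, 0, 0, 0]", simplified dF_eval, simplified, simplified mult_vec_eval, simplified, simplified d, simplified]
  note e3 = H[of "vector [0, 0, 1, 0, 0, 1, 0, 0]", simplified dF_eval, simplified, simplified mult_vec_eval, simplified, simplified d, simplified]
  note e4 = H[of "vector [0, 0, 1, 0, 1, 0, 0, 0]", simplified dF_eval, simplified, simplified mult_vec_eval, simplified, simplified d, simplified]
  note e5 = H[of "vector [0, 0, 0, 1, 2, 0, 0, 0]", simplified dF_eval, simplified, simplified mult_vec_eval, simplified, simplified d, simplified]
  note e6 = H[of "vector [0, 0, 1, 0, 0, 2, 0, 0]", simplified dF_eval, simplified, simplified mult_vec_eval, simplified, simplified d, simplified]
  show "B$4$5 = B$3$6/3" "B$4$6 = B$3$5 - 2 * B$3$6/3" "B$5$3 = - B$3$5" "B$5$4 = - B$3$6" "B$6$3 = - B$3$6/3"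
    "B$6$4 = - B$3$5 + 2 * B$3$6/3"
    using e1 e2 e3 e4 e5 e6 by linarith+
qed

lemma lie_pair_24:
  shows "B$3$8 = 3 * B$3$7" "B$4$8 = - B$4$7" "B$7$3 = - B$3$7" "B$7$4 = - 3 * B$4$7" "B$8$3 = - B$3$7"
    "B$8$4 = B$4$7"
proof -
  note d = lie_diag
  note e1 = H[of "vector [0, 0, 0, 1, 0, 0, 0, 1]", simplified dF_eval, simplified, simplified mult_vec_eval, simplified, simplified d, simplified]
  note e2 = H[of "vector [0, 0, 0, 1, 0, 0, 1, 0]", simplified dF_eval, simplified, simplified mult_vec_eval, simplified, simplified d, simplified]
  note e3 = H[of "vector [0, 0, 1, 0, 0, 0, 0, 1]", simplified dF_eval, simplified, simplified mult_vec_eval, simplified, simplified d, simplified]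
  note e4 = H[of "vector [0, 0, 1, 0, 0, 0, 1, 0]", simplified dF_eval, simplified, simplified mult_vec_eval, simplified, simplified d, simplified]
  note e5 = H[of "vector [0, 0, 0, 1, 0, 0, 0, 2]", simplified dF_eval, simplified, simplified mult_vec_eval, simplified, simplified d, simplified]
  note e6 = H[of "vector [0, 0, 1, 0, 0, 0, 0, 2]", simplified dF_eval, simplified, simplified mult_vec_eval, simplified, simplified d, simplified]
  show "B$3$8 = 3 * B$3$7" "B$4$8 = - B$4$7" "B$7$3 = - B$3$7" "B$7$4 = - 3 * B$4$7" "B$8$3 = - B$3$7" "B$8$4 = B$4$7"
    using e1 e2 e3 e4 e5 e6 by linarith+
qed

lemma lie_pair_34:
  shows "B$5$8 = 0" "B$6$7 = 0" "B$7$5 = - B$5$7" "B$7$6 = 0" "B$8$5 = 0" "B$8$6 = - B$6$8"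
proof -
  note d = lie_diag
  note e1 = H[of "vector [0, 0, 0, 0, 0, 1, 0, 1]", simplified dF_eval, simplified, simplified mult_vec_eval, simplified, simplified d, simplified]
  note e2 = H[of "vector [0, 0, 0, 0, 0, 1, 1, 0]", simplified dF_eval, simplified, simplified mult_vec_eval, simplified, simplified d, simplified]
  note e3 = H[of "vector [0, 0, 0, 0, 1, 0, 0, 1]", simplified dF_eval, simplified, simplified mult_vec_eval, simplified, simplified d, simplified]
  note e4 = H[of "vector [0, 0, 0, 0, 1, 0, 1, 0]", simplified dF_eval, simplified, simplified mult_vec_eval, simplified, simplified d, simplified]
  note e5 = H[of "vector [0, 0, 0, 0, 0, 1, 2, 0]", simplified dF_eval, simplified, simplified mult_vec_eval, simplified, simplified d, simplified]
  note e6 = H[of "vector [0, 0, 0, 0, 1, 0, 0, 2]", simplified dF_eval, simplified, simplified mult_vec_eval, simplified, simplified d, simplified]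
  show "B$5$8 = 0" "B$6$7 = 0" "B$7$5 = - B$5$7" "B$7$6 = 0" "B$8$5 = 0" "B$8$6 = - B$6$8"
    using e1 e2 e3 e4 e5 e6 by linarith+
qed

text \<open>The six couples of pairs leave 12 parameters. Points meeting three pairs relate
  parameters of different couples; the six relations found reduce them to 6, the dimension of su(2)
  + su(2).\<close>

lemma lie_triple:
  shows "B$3$5 = - 2 * B$1$7 - B$2$7" "B$3$6 = - 3 * B$1$7" "B$3$7 = - B$1$6/3" "B$4$7 = - B$1$5 - 2 * B$1$6/3"
    "B$5$7 = - 2 * B$1$4/3" "B$6$8 = - 2 * B$1$3 - 4 * B$1$4/3"
proof -
  note d = lie_diag lie_pair_12 lie_pair_13 lie_pair_14 lie_pair_23 lie_pair_24 lie_pair_34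
  note e1 = H[of "vector [0, 1, 0, 1, 1, 0, 0, 0]", simplified dF_eval, simplified, simplified mult_vec_eval, simplified, simplified d, simplified]
  note e2 = H[of "vector [0, 1, 0, -1, 1, 0, 0, 0]", simplified dF_eval, simplified, simplified mult_vec_eval, simplified, simplified d, simplified]
  note e3 = H[of "vector [0, 1, 1, 0, 0, 1, 0, 0]", simplified dF_eval, simplified, simplified mult_vec_eval, simplified, simplified d, simplified]
  note e4 = H[of "vector [0, 1, 1, 0, 1, 0, 0, 0]", simplified dF_eval, simplified, simplified mult_vec_eval, simplified, simplified d, simplified]
  note e5 = H[of "vector [0, 1, 1, 0, -1, 0, 0, 0]", simplified dF_eval, simplified, simplified mult_vec_eval, simplified, simplified d, simplified]
  note e6 = H[of "vector [1, 0, 0, 1, 1, 0, 0, 0]", simplified dF_eval, simplified, simplified mult_vec_eval, simplified, simplified d, simplified]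
  show "B$3$5 = - 2 * B$1$7 - B$2$7" "B$3$6 = - 3 * B$1$7" "B$3$7 = - B$1$6/3" "B$4$7 = - B$1$5 - 2 * B$1$6/3"
    "B$5$7 = - 2 * B$1$4/3" "B$6$8 = - 2 * B$1$3 - 4 * B$1$4/3"
    using e1 e2 e3 e4 e5 e6 by linarith+
qed


end

lemma lie_coords: 
  fixes B :: "real^8^8"
  assumes H: "\<And>u. dF (scl u) (scl (B *v u)) = 0"
  shows "\<exists>v w. v $ 1 = 0 \<and> w $ 1 = 0 \<and> B = lie_mat v w"
proof (intro exI conjI)
  \<comment> \<open>Obtained by solving entries in the first two rows of \<open>lie_mat v w\<close>
    for v and w; for example \<open>3 * B$1$3 + B$1$4 = 6 * w$2\<close>.\<close>
  let ?v = "vector [0, 3/2 * B$1$7 - B$2$7/2, B$1$5/2 + 5/6 * B$1$6, B$1$3/2 + 5/6 * B$1$4] :: real^4"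
  let ?w = "vector [0, B$1$3/2 + B$1$4/6, B$1$5/2 + B$1$6/6, (B$1$7 + B$2$7)/2] :: real^4"
  show "?v $ 1 = 0" "?w $ 1 = 0" by simp_all
  show "B = lie_mat ?v ?w"
    unfolding vec_eq_iff forall_8 lie_mat_def vector_8 vector_4
      lie_diag[OF H] lie_pair_12[OF H] lie_pair_13[OF H] lie_pair_14[OF H] lie_pair_23[OF H] lie_pair_24[OF H]
      lie_pair_34[OF H] lie_triple[OF H]
    by (intro conjI) (simp_all add: field_simps)
qed

lemma opS_opT_scl:
  assumes "v $ 1 = 0" "w $ 1 = 0"
  shows "opS v (scl u) + opT w (scl u) = scl (lie_mat v w *v u)"
proof -
  have "alpha (opS v (scl u) + opT w (scl u)) = alpha (scl (lie_mat v w *v u))"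
    unfolding vec_eq_iff forall_3 forall_4 linear_add[OF linear_alpha] alpha_opS alpha_opT[OF assms(2)] vector_add_component
      matrix_matrix_mult_def transpose_def sum_3 sum_4 vec_lambda_beta alpha_scl_nth
      QL_def QR_def r3_def vector_4 vector_3 matrix_vector_mult_def sum_8 lie_mat_def vector_8
    using assms
    by (intro conjI; simp only: mult_zero_left mult_zero_right add_0_left add_0_right minus_zero;
        simp add: algebra_simps add_divide_distrib diff_divide_distrib)
  then show ?thesis by (simp add: inj_alpha)
qed
lemma lie_algebra_of_F:
  assumes f: "linear f" and "\<And>x. dF x (f x) = 0"
  obtains v w where "v $ 1 = 0" "w $ 1 = 0" "\<And>x. f x = opS v x + opT w x"
proof -
  define scl' :: "real^8 \<Rightarrow> real^8" where
    "scl' u = vector [u$1, u$2 / sqrt 3, u$3, u$4 / sqrt 3, u$5, u$6 / sqrt 3, u$7, u$8 / sqrt 3]" for u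
  have s: "scl (scl' u) = u" "scl' (scl u) = u" for u
    by (simp_all add: vec_eq_iff forall_8 scl_def scl'_def)
  have "linear scl" "linear scl'"
    by (rule linearI; simp add: vec_eq_iff forall_8 scl_def scl'_def algebra_simps add_divide_distrib)+
  then have "linear (scl' \<circ> f \<circ> scl)"
    by (intro linear_compose f)
  then have B: "f (scl u) = scl (matrix (scl' \<circ> f \<circ> scl) *v u)" for u
    by (simp add: matrix_works s)
  obtain v w where vw: "v $ 1 = 0" "w $ 1 = 0" "matrix (scl' \<circ> f \<circ> scl) = lie_mat v w"
    using lie_coords[of "matrix (scl' \<circ> f \<circ> scl)"] assms(2) by (metis B)
  show thesis
  proof
    fix x show "f x = opS v x + opT w x"
      using B[of "scl' x"] opS_opT_scl[OF vw(1,2), of "scl' x"] by (simp add: s vw(3))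
  qed (fact vw)+
qed

section \<open>Matrix exponentials\<close>

lemma matrix_scaleR_simps:
  fixes A B :: "'a::real_algebra_1^'n^'n"
  shows "A ** (c *\<^sub>R B) = c *\<^sub>R (A ** B)" "(c *\<^sub>R A) ** B = c *\<^sub>R (A ** B)"
  by (simp_all add: matrix_matrix_mult_def vec_eq_iff scaleR_sum_right)

text \<open>Rodrigues' formula for two generators that annihilate each other. Two angles are needed
  because the exponential of \<open>t *\<^sub>R \<sigma>1\<close> turns the upper block by t and the
  lower block by t/2.\<close>

lemma mexp_rotation:
  fixes P Q :: "'a::real_normed_field^'n^'n"
  assumes P: "P ** (P ** P) = - P" and Q: "Q ** (Q ** Q) = - Q" and PQ: "P ** Q = 0" "Q ** P = 0"
  shows "mexp (a *\<^sub>R P + b *\<^sub>R Q) =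
    mat 1 + (sin a *\<^sub>R P + (1 - cos a) *\<^sub>R (P ** P)) + (sin b *\<^sub>R Q + (1 - cos b) *\<^sub>R (Q ** Q))"
proof -
  let ?A = "a *\<^sub>R P + b *\<^sub>R Q"
  \<comment> \<open>The indicator of n = 0 carries both the identity matrix and the constant 1 in
    \<open>1 - cos a\<close>; thus \<open>?T n\<close> collects the Taylor terms of order n.\<close>
  let ?d = "\<lambda>n::nat. if n = 0 then 1 else 0 :: real"
  let ?T = "\<lambda>n. ?d n *\<^sub>R mat 1 +
     ((sin_coeff n * a ^ n) *\<^sub>R P + (?d n - cos_coeff n * a ^ n) *\<^sub>R (P ** P)) +
     ((sin_coeff n * b ^ n) *\<^sub>R Q + (?d n - cos_coeff n * b ^ n) *\<^sub>R (Q ** Q)) :: 'a^'n^'n"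
  have PQ': "P ** (Q ** X) = 0" "Q ** (P ** X) = 0" for X
    by (simp_all add: matrix_mul_assoc PQ)
  have pow: "((**) ?A ^^ n) (mat 1) = fact n *\<^sub>R ?T n" for n
  proof (induction n)
    case (Suc n)
    have "((**) ?A ^^ Suc n) (mat 1) = fact n *\<^sub>R (?A ** ?T n)"
      by (simp add: Suc matrix_scaleR_simps)
    also have "?A ** ?T n = of_nat (Suc n) *\<^sub>R ?T (Suc n)"
      by (simp add: matrix_add_distrib_right matrix_add_ldistrib matrix_diff_distrib matrix_scaleR_simps PQ PQ' P Q
          sin_coeff_Suc cos_coeff_Suc algebra_simps del: of_nat_Suc)
    finally show ?case by (simp add: mult.commute)
  qed simp
  have d: "(\<lambda>n. ?d n *\<^sub>R X) sums (1 *\<^sub>R X)" for X :: "'a^'n^'n"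
    by (intro sums_scaleR_left) (use sums_single[of 0 "\<lambda>_. 1::real"] in \<open>simp add: eq_commute\<close>)
  have s: "(\<lambda>n. sin_coeff n * x ^ n) sums sin x" and c: "(\<lambda>n. ?d n - cos_coeff n * x ^ n) sums (1 - cos x)" for x
    using sin_converges[of x] sums_diff[OF sums_single[of 0 "\<lambda>_. 1::real"] cos_converges[of x]]
    by (simp_all add: eq_commute)
  have "?T sums (1 *\<^sub>R mat 1 + (sin a *\<^sub>R P + (1 - cos a) *\<^sub>R (P ** P)) + (sin b *\<^sub>R Q + (1 - cos b) *\<^sub>R (Q ** Q)))"
    by (intro sums_add d sums_scaleR_left s c)
  then show ?thesis
    unfolding mexp_def pow by (simp add: sums_iff)
qed

lemma matrix_mul_zero [simp]: "0 ** A = (0 :: 'a::semiring_1^'n^'m)" "B ** 0 = (0 :: 'a^'n^'m)"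
  by (simp_all add: matrix_matrix_mult_def vec_eq_iff)

lemma bd_zero: "bd 0 0 = 0" and bd_minus: "- bd R Q = bd (- R) (- Q)"
  by (simp_all add: vec_eq_iff forall_7 bd_def)

definition qi :: "real^4" where "qi = vector [0, 1, 0, 0]"
definition qj :: "real^4" where "qj = vector [0, 0, 1, 0]"
definition qk :: "real^4" where "qk = vector [0, 0, 0, 1]"

text \<open>The exponential of tq/2 when q is a unit imaginary quaternion.\<close>

definition cis_q :: "real^4 \<Rightarrow> real \<Rightarrow> real^4" where
  "cis_q q t = cos (t / 2) *\<^sub>R qone + sin (t / 2) *\<^sub>R q"

text \<open>The 7-dimensional representation in quaternionic form; for unit p and q these matrices
  are exactly \<open>H7\<close>, see \<open>H7_eq\<close>.\<close>

definition K7 :: "real^4 \<Rightarrow> real^4 \<Rightarrow> real^7^7" where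
  "K7 p q = bd (R3 q) (QL p ** QR q)"

lemma QL_QR_mult: "(QL p ** QR q) ** (QL p' ** QR q') = QL (qmul p p') ** QR (qmul q q')"
proof -
  have "(QL p ** QR q) ** (QL p' ** QR q') = QL p ** (QR q ** QL p') ** QR q'"
    by (simp add: matrix_mul_assoc)
  also have "\<dots> = (QL p ** QL p') ** (QR q ** QR q')"
    by (simp only: QL_QR_commute[symmetric] matrix_mul_assoc)
  finally show ?thesis by (simp add: QL_mult QR_mult)
qed

lemma K7_mult: "K7 p q ** K7 p' q' = K7 (qmul p p') (qmul q q')"
  by (simp add: K7_def bd_mult R3_mult QL_QR_mult)

lemma K7_one: "K7 qone qone = mat 1"
  by (simp add: K7_def R3_one QL_one QR_one bd_one)

lemma L_mat_nth: "L_mat a b $ i $ j = (if i = a \<and> j = b then 1 else 0) - (if i = b \<and> j = a then 1 else 0)"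
  by (simp add: L_mat_def E_mat_def)

lemma generators:
  "s1 = (1/2) *\<^sub>R bd 0 (QL qi)" "s2 = (1/2) *\<^sub>R bd 0 (QL qj)" "s3 = (1/2) *\<^sub>R bd 0 (QL qk)"
  "\<sigma>1 = bd ((1/2) *\<^sub>R r3 qi) 0 + (1/2) *\<^sub>R bd 0 (QR qi)"
  "\<sigma>2 = bd ((1/2) *\<^sub>R r3 qj) 0 + (1/2) *\<^sub>R bd 0 (QR qj)"
  "\<sigma>3 = bd ((1/2) *\<^sub>R r3 qk) 0 + (1/2) *\<^sub>R bd 0 (QR qk)"
  unfolding vec_eq_iff forall_7 s1_def s2_def s3_def \<sigma>1_def \<sigma>2_def \<sigma>3_def
  by (intro conjI; simp only: vector_scaleR_component vector_minus_component vector_uminus_component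
      vector_add_component L_mat_nth; simp add: bd_def; simp add: QL_def QR_def r3_def qi_def qj_def qk_def)+

lemma qmul_imag: "q $ 1 = 0 \<Longrightarrow> qmul q q = - (q \<bullet> q) *\<^sub>R qone"
  by (simp add: mat_simps qmul_def qone_def inner_vec_def)

lemma QL_cis: "QL (cis_q q t) = cos (t/2) *\<^sub>R mat 1 + sin (t/2) *\<^sub>R QL q"
  and QR_cis: "QR (cis_q q t) = cos (t/2) *\<^sub>R mat 1 + sin (t/2) *\<^sub>R QR q"
  by (simp_all add: mat_simps QL_def QR_def cis_q_def qone_def)

lemma mexp_QL:
  assumes "q $ 1 = 0" "q \<bullet> q = 1"
  shows "mexp (t *\<^sub>R ((1/2) *\<^sub>R bd 0 (QL q))) = K7 (cis_q q t) qone"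
proof -
  have QQ: "QL q ** QL q = - mat 1"
    using assms by (simp add: QL_mult qmul_imag QL_minus QL_one)
  have "mexp (t *\<^sub>R ((1/2) *\<^sub>R bd 0 (QL q))) = mexp (0 *\<^sub>R 0 + (t/2) *\<^sub>R bd 0 (QL q))"
    by simp
  also have "\<dots> = mat 1 + (sin (t/2) *\<^sub>R bd 0 (QL q) + (1 - cos (t/2)) *\<^sub>R bd 0 (- mat 1))"
    by (subst mexp_rotation) (simp_all add: bd_mult QQ matrix_mul_minus bd_minus)
  also have "\<dots> = K7 (cis_q q t) qone"
    by (simp add: K7_def R3_one QR_one QL_cis bd_add scaleR_bd flip: bd_one) (simp add: algebra_simps)
  finally show ?thesis .
qed

lemma R3_affine:
  "q $ 1 = 0 \<Longrightarrow> R3 (c *\<^sub>R qone + s *\<^sub>R q) = c\<^sup>2 *\<^sub>R mat 1 + ((c * s) *\<^sub>R r3 q + s\<^sup>2 *\<^sub>R R3 q)"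
  by (simp add: vec_eq_iff forall_3 mat_def R3_def r3_def qone_def power2_eq_square algebra_simps)

lemma r3_square:
  "q $ 1 = 0 \<Longrightarrow> r3 q ** r3 q = 2 *\<^sub>R R3 q - (2 * (q \<bullet> q)) *\<^sub>R mat 1"
  by (simp add: vec_eq_iff forall_3 matrix_matrix_mult_def sum_3 mat_def R3_def r3_def inner_vec_def sum_4 power2_eq_square algebra_simps)
text \<open>The double angle formulas: a quaternion with half angle t/2 rotates 3-space by
  t.\<close>

lemma R3_cis:
  assumes "q $ 1 = 0" "q \<bullet> q = 1"
  defines "K \<equiv> (1/2) *\<^sub>R r3 q"
  shows "R3 (cis_q q t) = mat 1 + (sin t *\<^sub>R K + (1 - cos t) *\<^sub>R (K ** K))"
proof -
  define c s where "c = cos (t/2)" and "s = sin (t/2)"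
  have t: "sin t = 2 * s * c" "1 - cos t = 2 * s\<^sup>2" and c2: "c\<^sup>2 = 1 - s\<^sup>2"
    using sin_double[of "t/2"] cos_double_sin[of "t/2"] by (simp_all add: c_def s_def cos_squared_eq)
  have KK: "K ** K = (1/2) *\<^sub>R (R3 q - mat 1)"
    using assms(1,2) by (simp add: K_def matrix_scaleR_simps r3_square scaleR_right_diff_distrib)
  show ?thesis
    unfolding cis_q_def c_def[symmetric] s_def[symmetric] t R3_affine[OF assms(1)] c2 KK
    by (simp add: K_def algebra_simps)
qed

lemma mexp_QR:
  assumes q: "q $ 1 = 0" "q \<bullet> q = 1"
  shows "mexp (t *\<^sub>R (bd ((1/2) *\<^sub>R r3 q) 0 + (1/2) *\<^sub>R bd 0 (QR q))) = K7 qone (cis_q q t)"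
proof -
  let ?K = "(1/2) *\<^sub>R r3 q"
  have QQ: "QR q ** QR q = - mat 1"
    using q by (simp add: QR_mult qmul_imag QR_minus QR_one)
  have "?K ** (?K ** ?K) = - (q \<bullet> q) *\<^sub>R ?K"
    using q(1) by (simp add: mat_simps r3_def inner_vec_def algebra_simps)
  then have K: "?K ** (?K ** ?K) = - ?K" using q by simp
  have "mexp (t *\<^sub>R (bd ?K 0 + (1/2) *\<^sub>R bd 0 (QR q))) = mexp (t *\<^sub>R bd ?K 0 + (t/2) *\<^sub>R bd 0 (QR q))"
    by (simp add: scaleR_right_distrib)
  also have "\<dots> = mat 1 + (sin t *\<^sub>R bd ?K 0 + (1 - cos t) *\<^sub>R bd (?K ** ?K) 0) +
        (sin (t/2) *\<^sub>R bd 0 (QR q) + (1 - cos (t/2)) *\<^sub>R bd 0 (- mat 1))"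
    by (subst mexp_rotation) (simp_all add: bd_mult QQ K bd_minus bd_zero matrix_mul_minus del: scaleR_half_double)
  also have "\<dots> = K7 qone (cis_q q t)"
    by (simp add: K7_def R3_cis[OF q] QL_one QR_cis bd_add scaleR_bd flip: bd_one) (simp add: algebra_simps)
  finally show ?thesis .
qed

section \<open>Euler angles for unit quaternions\<close>

definition euler_q :: "real \<Rightarrow> real \<Rightarrow> real \<Rightarrow> real^4" where
  "euler_q t1 t2 t3 = qmul (qmul (cis_q qi t1) (cis_q qj t2)) (cis_q qk t3)"

lemma imag_units: "qi $ 1 = 0" "qj $ 1 = 0" "qk $ 1 = 0" "qi \<bullet> qi = 1" "qj \<bullet> qj = 1" "qk \<bullet> qk = 1"
  by (simp_all add: qi_def qj_def qk_def inner_vec_def sum_4)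

lemma h_mat_eq: "h_mat t1 t2 t3 \<tau>1 \<tau>2 \<tau>3 = K7 (euler_q t1 t2 t3) (euler_q \<tau>1 \<tau>2 \<tau>3)"
  unfolding h_mat_def generators mexp_QL[OF imag_units(1,4)] mexp_QL[OF imag_units(2,5)] mexp_QL[OF imag_units(3,6)]
    mexp_QR[OF imag_units(1,4)] mexp_QR[OF imag_units(2,5)] mexp_QR[OF imag_units(3,6)]
    K7_mult qone_simps euler_q_def ..

lemma inner_qone_plus:
  "q $ 1 = 0 \<Longrightarrow> (c *\<^sub>R qone + s *\<^sub>R q) \<bullet> (c *\<^sub>R qone + s *\<^sub>R q) = c * c + s * s * (q \<bullet> q)"
  by (simp add: inner_vec_def sum_4 qone_def algebra_simps)

lemma cis_q_unit:
  assumes "q $ 1 = 0" "q \<bullet> q = 1"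
  shows "cis_q q t \<bullet> cis_q q t = 1"
  unfolding cis_q_def inner_qone_plus[OF assms(1)] assms(2) mult_1_right by (rule sin_cos_squared_add3)

lemma euler_q_unit: "euler_q t1 t2 t3 \<bullet> euler_q t1 t2 t3 = 1"
  by (simp add: euler_q_def inner_qmul cis_q_unit imag_units)

text \<open>This makes products of three exponentials in a fixed order exhaust the group, as the
  parametrization of \<open>H7\<close> demands.\<close>

lemma euler_q_surj:
  assumes "q \<bullet> q = 1"
  obtains t1 t2 t3 where "q = euler_q t1 t2 t3"
proof -
  define w x y z where "w = q$1" and "x = q$2" and "y = q$3" and "z = q$4"
  have n: "w\<^sup>2 + x\<^sup>2 + y\<^sup>2 + z\<^sup>2 = 1"
    using assms by (simp add: inner_vec_def sum_4 w_def x_def y_def z_def power2_eq_square)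
  \<comment> \<open>For an Euler product with half angles p, b, p', the complex numbers (w + y) +
    i(x + z) and (w - y) + i(x - z) have arguments p + p' and p - p' and signed moduli cos b + sin b
    and cos b - sin b. Hence polar coordinates of the two give all three angles.\<close>
  obtain r a where ra: "w + y = r * cos a" "x + z = r * sin a"
    using polar_Ex by metis
  obtain r' a' where ra': "w - y = r' * cos a'" "x - z = r' * sin a'"
    using polar_Ex by metis
  have r: "r\<^sup>2 = (w + y)\<^sup>2 + (x + z)\<^sup>2" "r'\<^sup>2 = (w - y)\<^sup>2 + (x - z)\<^sup>2"
    unfolding ra ra' power_mult_distrib by (simp_all flip: distrib_left)
  have "((r + r')/2)\<^sup>2 + ((r - r')/2)\<^sup>2 = 1"
    using n r by (simp add: power2_eq_square field_simps)
  then obtain b where b: "(r + r')/2 = cos b" "(r - r')/2 = sin b"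
    using sincos_total_2pi by metis
  define p p' where "p = (a + a') / 2" and "p' = (a - a') / 2"
  have a: "a = p + p'" "a' = p - p'"
    by (simp_all add: p_def p'_def field_simps)
  have r: "r = cos b + sin b" "r' = cos b - sin b"
    using b by (simp_all add: field_simps)
  note e = ra[unfolded a(1) cos_add sin_add r(1)] ra'[unfolded a(2) cos_diff sin_diff r(2)]
  have "w = cos p * cos b * cos p' - sin p * sin b * sin p'"
    "y = cos p * sin b * cos p' - sin p * cos b * sin p'"
    "x = sin p * cos b * cos p' + cos p * sin b * sin p'"
    "z = sin p * sin b * cos p' + cos p * cos b * sin p'"
    using e by (simp_all add: algebra_simps)
  then have "q = euler_q (2 * p) (2 * b) (2 * p')"
    by (simp add: mat_simps w_def x_def y_def z_def euler_q_def cis_q_def qmul_def qi_def qj_def qk_def qone_def)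
  then show thesis by (rule that)
qed

section \<open>The group and its representations\<close>

text \<open>The linear embedding sending \<open>qone\<close> to the identity and \<open>qi\<close>,
  \<open>qj\<close>, \<open>qk\<close> to twice \<open>e1\<close>, \<open>e2\<close>,
  \<open>e3\<close>, which makes it multiplicative.\<close>

definition su2_mat :: "real^4 \<Rightarrow> complex^2^2" where
  "su2_mat q = vector
    [vector [Complex (q$1) (- q$4), Complex (- q$3) (- q$2)],
     vector [Complex (q$3) (- q$2), Complex (q$1) (q$4)]]"

definition su2_quat :: "complex^2^2 \<Rightarrow> real^4" where
  "su2_quat u = vector [Re (u$1$1), - Im (u$1$2), - Re (u$1$2), - Im (u$1$1)]"

lemma su2_quat_mat: "su2_quat (su2_mat q) = q"
  by (simp add: su2_quat_def su2_mat_def vec_eq_iff forall_4)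

lemma su2_mat_mult: "su2_mat p ** su2_mat q = su2_mat (qmul p q)"
  by (simp add: su2_mat_def vec_eq_iff forall_2 matrix_matrix_mult_def sum_2 complex_eq_iff qmul_def algebra_simps)

lemma su2_mat_one: "su2_mat qone = mat 1"
  by (simp add: su2_mat_def qone_def vec_eq_iff forall_2 mat_def complex_eq_iff)

lemma SU2_eq: "SU2 = su2_mat ` {q. q \<bullet> q = 1}"
proof (intro equalityI subsetI)
  fix u assume "u \<in> SU2"
  then have u: "u$1$1 * cnj (u$1$1) + u$1$2 * cnj (u$1$2) = 1" "u$2$1 * cnj (u$1$1) + u$2$2 * cnj (u$1$2) = 0"
    and d: "u$1$1 * u$2$2 - u$1$2 * u$2$1 = 1"
    by (auto simp: SU2_def vec_eq_iff forall_2 matrix_matrix_mult_def sum_2 mat_def det_2)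
  have "u$2$2 = cnj (u$1$1)" "u$2$1 = - cnj (u$1$2)"
    using u d by algebra+
  then have "u = su2_mat (su2_quat u)"
    by (simp add: su2_mat_def su2_quat_def vec_eq_iff forall_2 complex_eq_iff)
  moreover have "su2_quat u \<bullet> su2_quat u = 1"
    using u(1) by (simp add: su2_quat_def inner_vec_def sum_4 complex_eq_iff)
  ultimately show "u \<in> su2_mat ` {q. q \<bullet> q = 1}" by blast
next
  fix u assume "u \<in> su2_mat ` {q. q \<bullet> q = 1}"
  then obtain q where "u = su2_mat q" "q \<bullet> q = 1" by blast
  then show "u \<in> SU2"
    by (simp add: SU2_def su2_mat_def inner_vec_def sum_4 vec_eq_iff forall_2 matrix_matrix_mult_def sum_2 mat_def det_2
        complex_eq_iff algebra_simps)
qed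

lemma su2_quat_mult:
  assumes "u \<in> SU2" "v \<in> SU2"
  shows "su2_quat (u ** v) = qmul (su2_quat u) (su2_quat v)"
  using assms by (auto simp: SU2_eq su2_mat_mult su2_quat_mat)

lemma mexp_su2_mat:
  assumes "q $ 1 = 0" "q \<bullet> q = 1"
  shows "mexp (t *\<^sub>R ((1/2) *\<^sub>R su2_mat q)) = su2_mat (cis_q q t)"
proof -
  have m: "su2_mat (- p) = - su2_mat p" for p
    by (simp add: su2_mat_def vec_eq_iff forall_2 complex_eq_iff)
  have QQ: "su2_mat q ** su2_mat q = - mat 1"
    using assms by (simp add: su2_mat_mult qmul_imag m su2_mat_one)
  have "mexp (t *\<^sub>R ((1/2) *\<^sub>R su2_mat q)) = mexp (0 *\<^sub>R 0 + (t/2) *\<^sub>R su2_mat q)"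
    by simp
  also have "\<dots> = mat 1 + (sin (t/2) *\<^sub>R su2_mat q + (1 - cos (t/2)) *\<^sub>R - mat 1)"
    by (subst mexp_rotation) (simp_all add: QQ matrix_mul_minus)
  also have "\<dots> = su2_mat (cis_q q t)"
    by (simp add: su2_mat_def cis_q_def qone_def mat_def vec_eq_iff forall_2 complex_eq_iff)
  finally show ?thesis .
qed

lemma su2_prod_eq: "su2_prod t1 t2 t3 = su2_mat (euler_q t1 t2 t3)"
proof -
  have e: "e1 = (1/2) *\<^sub>R su2_mat qi" "e2 = (1/2) *\<^sub>R su2_mat qj" "e3 = (1/2) *\<^sub>R su2_mat qk"
    by (simp_all add: e1_def e2_def e3_def su2_mat_def qi_def qj_def qk_def vec_eq_iff forall_2 complex_eq_iff)
  show ?thesis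
    unfolding su2_prod_def e mexp_su2_mat[OF imag_units(1,4)] mexp_su2_mat[OF imag_units(2,5)]
      mexp_su2_mat[OF imag_units(3,6)] su2_mat_mult euler_q_def ..
qed

definition phi7 :: "(complex^2^2) \<times> (complex^2^2) \<Rightarrow> real^7^7" where
  "phi7 g = K7 (su2_quat (fst g)) (su2_quat (snd g))"

lemma phi7_image: "phi7 ` (SU2 \<times> SU2) = {K7 p q | p q. p \<bullet> p = 1 \<and> q \<bullet> q = 1}"
  unfolding SU2_eq by (force simp: phi7_def su2_quat_mat image_iff)

lemma H7_eq: "H7 = {K7 p q | p q. p \<bullet> p = 1 \<and> q \<bullet> q = 1}"
proof (intro equalityI subsetI)
  fix h assume "h \<in> {K7 p q | p q. p \<bullet> p = 1 \<and> q \<bullet> q = 1}"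
  then obtain p q where h: "h = K7 p q" "p \<bullet> p = 1" "q \<bullet> q = 1" by blast
  obtain t1 t2 t3 where "p = euler_q t1 t2 t3" using h(2) by (rule euler_q_surj)
  moreover obtain \<tau>1 \<tau>2 \<tau>3 where "q = euler_q \<tau>1 \<tau>2 \<tau>3" using h(3) by (rule euler_q_surj)
  ultimately show "h \<in> H7" unfolding H7_def h_mat_eq h(1) by blast
qed (unfold H7_def h_mat_eq, blast intro: euler_q_unit)

section \<open>Continuity and multiplicativity of the representations\<close>

lemma continuous_on_vec:
  fixes f :: "'a::topological_space \<Rightarrow> 'b::topological_space^'n"
  assumes "\<And>i. continuous_on S (\<lambda>x. f x $ i)"
  shows "continuous_on S f"
  using continuous_on_vec_lambda[of S "\<lambda>i x. f x $ i"] assms by simp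

lemma continuous_on_matrix_mult:
  fixes f :: "'a::topological_space \<Rightarrow> real^'n^'m" and g :: "'a \<Rightarrow> real^'k^'n"
  assumes "continuous_on S f" "continuous_on S g"
  shows "continuous_on S (\<lambda>x. f x ** g x)"
  unfolding matrix_matrix_mult_def by (intro continuous_on_vec_lambda continuous_intros assms)

lemma continuous_on_transpose:
  fixes f :: "'a::topological_space \<Rightarrow> real^'n^'m"
  assumes "continuous_on S f"
  shows "continuous_on S (\<lambda>x. transpose (f x))"
  unfolding transpose_def by (intro continuous_on_vec_lambda continuous_intros assms)

lemma continuous_on_linear_comp:
  fixes f :: "'a::euclidean_space \<Rightarrow> 'b::euclidean_space"
  shows "linear f \<Longrightarrow> continuous_on S g \<Longrightarrow> continuous_on S (\<lambda>x. f (g x))"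
  using continuous_on_compose2[OF linear_continuous_on] by (metis linear_conv_bounded_linear subset_UNIV)

lemma linear_QL: "linear QL" and linear_QR: "linear QR"
  by (rule linearI; simp add: mat_simps QL_def QR_def algebra_simps)+

lemma continuous_on_R3: "continuous_on S q \<Longrightarrow> continuous_on S (\<lambda>x. R3 (q x))"
proof (intro continuous_on_vec)
  fix i j
  assume q: "continuous_on S q"
  have c: "continuous_on S (\<lambda>x. q x $ k * q x $ l)" "continuous_on S (\<lambda>x. (q x $ k)\<^sup>2)" for k l
    by (intro continuous_on_mult continuous_on_power continuous_on_component q)+
  show "continuous_on S (\<lambda>x. R3 (q x) $ i $ j)"
    using exhaust_3[of i] exhaust_3[of j]
    by (auto simp: R3_def mult.assoc intro!: continuous_on_add continuous_on_diff continuous_on_minus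
        continuous_on_mult_left c)
qed

lemma continuous_on_bd:
  fixes f :: "'a::topological_space \<Rightarrow> real^3^3" and g :: "'a \<Rightarrow> real^4^4"
  assumes "continuous_on S f" "continuous_on S g"
  shows "continuous_on S (\<lambda>x. bd (f x) (g x))"
proof -
  have "linear (\<lambda>p. bd (fst p) (snd p) :: real^7^7)"
    by (rule linearI) (simp_all add: bd_add scaleR_bd)
  then show ?thesis
    using continuous_on_linear_comp[OF _ continuous_on_Pair[OF assms]] by fastforce
qed

lemma linear_su2_quat: "linear su2_quat"
  by (rule linearI) (simp_all add: su2_quat_def vec_eq_iff forall_4)

lemmas continuous_on_phi7_intros = continuous_on_bd continuous_on_matrix_mult continuous_on_transpose continuous_on_R3
  continuous_on_linear_comp[OF linear_QL] continuous_on_linear_comp[OF linear_QR] continuous_on_linear_comp[OF linear_su2_quat]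
  continuous_on_fst continuous_on_snd continuous_on_id continuous_on_const

lemma SU2xSU2_rep_phi7: "SU2xSU2_rep phi7"
  unfolding SU2xSU2_rep_def
proof (intro conjI ballI)
  show "continuous_on (SU2 \<times> SU2) phi7"
    unfolding phi7_def[abs_def] K7_def
    by (intro continuous_on_phi7_intros)
  show "phi7 (mat 1, mat 1) = mat 1"
    by (simp add: phi7_def su2_quat_mat K7_one flip: su2_mat_one)
  fix u v u' v' assume "u \<in> SU2" "v \<in> SU2" "u' \<in> SU2" "v' \<in> SU2"
  then show "phi7 (u ** u', v ** v') = phi7 (u, v) ** phi7 (u', v')"
    by (simp add: phi7_def su2_quat_mult K7_mult)
qed

lemma phi7_su2_prod:
  "phi7 (su2_prod t1 t2 t3, su2_prod \<tau>1 \<tau>2 \<tau>3) = h_mat t1 t2 t3 \<tau>1 \<tau>2 \<tau>3"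
  by (simp add: phi7_def su2_prod_eq su2_quat_mat h_mat_eq)

lemma iota_gact: "iota (gact p q x) = K7 p q ** iota x ** transpose (K7 p q)"
  by (simp add: iota_offd K7_def transpose_bd bd_offd offd_bd alpha_gact matrix_transpose_mul matrix_mul_assoc
      matrix_mul_minus)

lemma rho_K7: "rho (K7 p q) = matrix (gact p q)"
  by (simp add: rho_def inv_f_f[OF inj_iota] flip: iota_gact)

lemma gact_gact: "gact p q (gact p' q' x) = gact (qmul p p') (qmul q q') x"
proof -
  have "transpose (QL (qmul p p') ** QR (qmul q q')) = transpose (QL p' ** QR q') ** transpose (QL p ** QR q)"
    by (metis QL_QR_mult matrix_transpose_mul)
  then show ?thesis
    by (simp add: inj_alpha[symmetric] alpha_gact matrix_mul_assoc flip: R3_mult)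
qed

lemma continuous_on_rho_phi7: "continuous_on S (\<lambda>g. rho (phi7 g))"
proof -
  have "continuous_on S (\<lambda>g. gact (su2_quat (fst g)) (su2_quat (snd g)) x)" for x
    unfolding gact_def
    by (intro continuous_on_linear_comp[OF linear_proj8] continuous_on_phi7_intros)
  then show ?thesis
    unfolding phi7_def rho_K7 matrix_def
    by (intro continuous_on_vec_lambda continuous_on_component)
qed

section \<open>Irreducibility\<close>

lemma opS_gact: "opS p x = gact p qone x"
  by (simp add: inj_alpha[symmetric] alpha_opS alpha_gact R3_one QR_one)

lemma QR_affine: "QR (c *\<^sub>R qone + s *\<^sub>R q) = c *\<^sub>R mat 1 + s *\<^sub>R QR q"
  by (simp add: mat_simps QR_def qone_def)

lemma QL_zero: "QL 0 = 0" and QR_zero: "QR 0 = 0" and r3_zero: "r3 0 = 0"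
  by (simp_all add: mat_simps QL_def QR_def r3_def)

text \<open>A difference formula recovers the derivative \<open>opT q\<close> because \<open>gact qone (c + s q)\<close> is cubic in \<open>(c, s)\<close>.\<close>

lemma opT_gact:
  assumes "q $ 1 = 0"
  shows "6 *\<^sub>R opT q x =
    (gact qone (2 *\<^sub>R qone + 1 *\<^sub>R q) x - gact qone (2 *\<^sub>R qone + (-1) *\<^sub>R q) x) -
    (gact qone (1 *\<^sub>R qone + 1 *\<^sub>R q) x - gact qone (1 *\<^sub>R qone + (-1) *\<^sub>R q) x)"
proof -
  let ?a = "alpha x" and ?Q = "transpose (QR q)"
  have h: "alpha (gact qone (c *\<^sub>R qone + s *\<^sub>R q) x) = c ^ 3 *\<^sub>R ?a + (c\<^sup>2 * s) *\<^sub>R (r3 q ** ?a + ?a ** ?Q) +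
      (c * s\<^sup>2) *\<^sub>R (R3 q ** ?a + r3 q ** ?a ** ?Q) + s ^ 3 *\<^sub>R (R3 q ** ?a ** ?Q)" for c s
    by (simp add: alpha_gact QL_one R3_affine[OF assms] QR_affine transpose_add transpose_scalar transpose_mat
        matrix_add_distrib_right matrix_add_ldistrib matrix_scalar_ac scalar_matrix_assoc[symmetric]
        power2_eq_square power3_eq_cube algebra_simps)
  \<comment> \<open>Differences between s = 1 and s = -1 keep twice the odd terms, with coefficients
    \<open>c\<^sup>2\<close> and 1; subtracting c = 1 from c = 2 removes the cubic term and leaves 2
    (4 - 1) = 6 times \<open>opT q x\<close>.\<close>
  show ?thesis
    unfolding inj_alpha[symmetric] linear_diff[OF linear_alpha] linear_scale[OF linear_alpha] alpha_opT[OF assms] h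
    by (simp add: vec_eq_iff algebra_simps)
qed

text \<open>The degrees 1 and 3 mirror the spins 1/2 and 3/2. This extends statements about unit
  quaternions to all quaternions and absorbs real scalars into p.\<close>

lemma gact_scale: "gact (a *\<^sub>R p) (b *\<^sub>R q) x = (a * b ^ 3) *\<^sub>R gact p q x"
proof -
  have "R3 (b *\<^sub>R q) = b\<^sup>2 *\<^sub>R R3 q" "QR (b *\<^sub>R q) = b *\<^sub>R QR q" "QL (a *\<^sub>R p) = a *\<^sub>R QL p"
    by (simp_all add: mat_simps R3_def QR_def QL_def power2_eq_square algebra_simps)
  then show ?thesis
    by (simp add: inj_alpha[symmetric] alpha_gact linear_scale[OF linear_alpha] transpose_scalar
        matrix_scalar_ac scalar_matrix_assoc[symmetric] power2_eq_square power3_eq_cube)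
qed

lemma opS_scl: "v $ 1 = 0 \<Longrightarrow> opS v (scl u) = scl (lie_mat v 0 *v u)"
proof -
  have "opT 0 x = 0" for x
    by (simp add: inj_alpha[symmetric] alpha_opT r3_zero QR_zero linear_0[OF linear_alpha] transpose_def zero_vec_def[symmetric])
  then show "v $ 1 = 0 \<Longrightarrow> ?thesis" using opS_opT_scl[of v 0 u] by simp
qed

lemma opT_scl: "w $ 1 = 0 \<Longrightarrow> opT w (scl u) = scl (lie_mat 0 w *v u)"
proof -
  have "opS 0 x = 0" for x
    by (simp add: inj_alpha[symmetric] alpha_opS QL_zero linear_0[OF linear_alpha] transpose_def zero_vec_def[symmetric])
  then show "w $ 1 = 0 \<Longrightarrow> ?thesis" using opS_opT_scl[of 0 w u] by simp
qed

lemma scl_inject: "scl u = scl v \<longleftrightarrow> u = v"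
  by (auto simp: vec_eq_iff forall_8 scl_def)

lemma scl_surj: obtains u where "x = scl u"
proof
  show "x = scl (vector [x$1, x$2 / sqrt 3, x$3, x$4 / sqrt 3, x$5, x$6 / sqrt 3, x$7, x$8 / sqrt 3])"
    by (simp add: vec_eq_iff forall_8 scl_def)
qed

lemma linear_scl: "linear scl"
  by (rule linearI) (simp_all add: vec_eq_iff forall_8 scl_def algebra_simps)

text \<open>Commuting antisymmetric generators of the two factors multiply to symmetric operators.
  These two preserve each of the four coordinate pairs, and the first is diagonal on the first
  pair.\<close>

lemma coupling_scl:
  "opS qi (opT qk (scl u)) = scl (vector [- u$1, 3 * u$2, - 2 * u$3 - 3 * u$4, - u$3, - 2 * u$5 - 3 * u$6, - u$5, 2 * u$7 + 3 * u$8, u$7])"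
  "opS qj (opT qj (scl u)) = scl (vector [2 * u$1 - 3 * u$2, - u$1, u$3, - 3 * u$4, 2 * u$5 - 3 * u$6, - u$5, - 2 * u$7 + 3 * u$8, u$7])"
  by (simp_all add: opS_scl opT_scl imag_units scl_inject)
     (simp_all add: vec_eq_iff forall_8 matrix_vector_mult_def sum_8 lie_mat_def qi_def qj_def qk_def field_simps)

text \<open>The first basis vector is a joint eigenvector of the symmetric operators \<open>opS q (opT q' _)\<close> that no other
  vector shares up to scaling, and it is cyclic.\<close>

lemma schur:
  assumes f: "linear f"
    and S: "\<And>q x. q $ 1 = 0 \<Longrightarrow> f (opS q x) = opS q (f x)"
    and T: "\<And>q x. q $ 1 = 0 \<Longrightarrow> f (opT q x) = opT q (f x)"
  obtains c where "\<And>x. f x = c *\<^sub>R x"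
proof -
  let ?e = "vector [1,0,0,0,0,0,0,0] :: real^8"
  obtain y where y: "f (scl ?e) = scl y" by (metis scl_surj)
  define D1 D2 where "D1 x = opS qi (opT qk x)" and "D2 x = opS qj (opT qj x)" for x
  have fD: "f (D1 x) = D1 (f x)" "f (D2 x) = D2 (f x)" for x
    by (simp_all add: D1_def D2_def S T imag_units)
  \<comment> \<open>Besides the first basis vector, the eigenspace of \<open>D1\<close> for -1
    contains only the direction (1, -1) of the fourth pair; on the second and third pairs the
    eigenvalues are 1 and -3.\<close>
  have "D1 (scl ?e) = - scl ?e"
    by (simp add: D1_def coupling_scl linear_neg[OF linear_scl, symmetric] scl_inject) (simp add: vec_eq_iff forall_8)
  then have "D1 (scl y) = - scl y"
    using fD(1)[of "scl ?e"] by (simp add: y linear_neg[OF f])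
  then have y1: "y$2 = 0" "y$3 = 0" "y$4 = 0" "y$5 = 0" "y$6 = 0" "y$8 = - y$7"
    by (simp_all add: D1_def coupling_scl linear_neg[OF linear_scl, symmetric] scl_inject)
       (simp_all add: vec_eq_iff forall_8)
  \<comment> \<open>The operator \<open>D2\<close> satisfies t^2 = 2t + 3 on the first pair but t^2
    = -2t + 3 on the fourth, where it is invertible; so the relation excludes a component in the
    fourth pair.\<close>
  have "D2 (D2 (scl ?e)) = 2 *\<^sub>R D2 (scl ?e) + 3 *\<^sub>R scl ?e"
    by (simp add: D2_def coupling_scl linear_scale[OF linear_scl, symmetric] linear_add[OF linear_scl, symmetric] scl_inject)
       (simp add: vec_eq_iff forall_8)
  from arg_cong[OF this, of f] have "D2 (D2 (scl y)) = 2 *\<^sub>R D2 (scl y) + 3 *\<^sub>R scl y"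
    by (simp add: fD y linear_add[OF f] linear_scale[OF f])
  then have y7: "y$7 = 0"
    by (simp add: D2_def coupling_scl linear_scale[OF linear_scl, symmetric] linear_add[OF linear_scl, symmetric] scl_inject)
       (simp add: vec_eq_iff forall_8 y1)
  define c where "c = y$1"
  have fe: "f (scl ?e) = c *\<^sub>R scl ?e"
    unfolding y by (simp add: c_def linear_scale[OF linear_scl, symmetric] scl_inject) (simp add: vec_eq_iff forall_8 y1 y7)
  have b1: "f (scl (vector [a,b,0,0,0,0,0,0])) = c *\<^sub>R scl (vector [a,b,0,0,0,0,0,0])" for a b
  proof -
    have e: "scl (vector [a,b,0,0,0,0,0,0]) = (a + 2 * b) *\<^sub>R scl ?e - b *\<^sub>R D2 (scl ?e)"
      by (simp add: D2_def coupling_scl linear_scale[OF linear_scl, symmetric] linear_diff[OF linear_scl, symmetric] scl_inject)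
        (simp add: vec_eq_iff forall_8)
    have "f (D2 (scl ?e)) = c *\<^sub>R D2 (scl ?e)"
      unfolding fD fe by (simp add: D2_def linear_scale[OF linear_opS] linear_scale[OF linear_opT])
    then show ?thesis
      unfolding e linear_diff[OF f] linear_scale[OF f] fe by (simp add: algebra_simps)
  qed
  \<comment> \<open>For unit imaginary q, \<open>opS q\<close> is a complex structure commuting with
    f, so x inherits the scalar c from its image in the first pair.\<close>
  have fS: "f x = c *\<^sub>R x" if "q $ 1 = 0" "q \<bullet> q = 1" "opS q x = scl (vector [a,b,0,0,0,0,0,0])" for q x a b
  proof -
    have "opS q (opS q x) = - x"
      using that(1,2) by (simp add: inj_alpha[symmetric] alpha_opS linear_neg[OF linear_alpha] QL_mult qmul_imag QL_minus QL_one
        matrix_mul_assoc[symmetric] transpose_minus matrix_mul_minus flip: matrix_transpose_mul)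
    then have "x = - opS q (opS q x)" by simp
    then have "f x = - opS q (f (opS q x))"
      using S[OF that(1)] linear_neg[OF f] by metis
    also have "\<dots> = c *\<^sub>R x"
      by (simp add: that(3) b1 linear_scale[OF linear_opS]) (simp add: \<open>opS q (opS q x) = - x\<close> flip: that(3))
    finally show ?thesis .
  qed
  have b: "f (scl (vector [0,0,a,b,0,0,0,0])) = c *\<^sub>R scl (vector [0,0,a,b,0,0,0,0])"
    "f (scl (vector [0,0,0,0,a,b,0,0])) = c *\<^sub>R scl (vector [0,0,0,0,a,b,0,0])"
    "f (scl (vector [0,0,0,0,0,0,a,b])) = c *\<^sub>R scl (vector [0,0,0,0,0,0,a,b])" for a b
    \<comment> \<open>The units k, j, i carry the second, third and fourth pair to the first; the
      witnesses are the resulting components, read off the first two rows of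
      \<open>lie_mat\<close>.\<close>
    by (rule fS[OF imag_units(3,6), of _ "- a / 2 + 3 * b / 2" "- a / 2 - b / 2"]
             fS[OF imag_units(2,5), of _ "- a / 2 + 3 * b / 2" "a / 2 + b / 2"]
             fS[OF imag_units(1,4), of _ "a / 2 - 3 * b / 2" "- a / 2 - b / 2"];
        simp add: opS_scl imag_units scl_inject;
        simp add: vec_eq_iff forall_8 matrix_vector_mult_def sum_8 lie_mat_def qi_def qj_def qk_def field_simps)+
  show thesis
  proof
    fix x
    obtain u where u: "x = scl u" by (rule scl_surj)
    have "u = vector [u$1,u$2,0,0,0,0,0,0] + vector [0,0,u$3,u$4,0,0,0,0] + vector [0,0,0,0,u$5,u$6,0,0] + vector [0,0,0,0,0,0,u$7,u$8]"
      by (simp add: vec_eq_iff forall_8)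
    then have "x = scl (vector [u$1,u$2,0,0,0,0,0,0]) + scl (vector [0,0,u$3,u$4,0,0,0,0]) + scl (vector [0,0,0,0,u$5,u$6,0,0]) +
        scl (vector [0,0,0,0,0,0,u$7,u$8])"
      unfolding u by (metis linear_add[OF linear_scl])
    then show "f x = c *\<^sub>R x"
      by (simp add: linear_add[OF f] b b1 scaleR_right_distrib)
  qed
qed

lemma inner_antisym:
  fixes f :: "'a::real_inner \<Rightarrow> 'a"
  assumes "linear f" "\<And>x. x \<bullet> f x = 0"
  shows "f x \<bullet> y = - (x \<bullet> f y)"
proof -
  have "(x + y) \<bullet> f (x + y) = 0" by (rule assms(2))
  then show ?thesis
    by (simp add: linear_add[OF assms(1)] inner_add_left inner_add_right assms(2) inner_commute[of y])
qed

lemma opS_antisym: "q $ 1 = 0 \<Longrightarrow> opS q x \<bullet> y = - (x \<bullet> opS q y)"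
  by (intro inner_antisym linear_opS inner_opS)

lemma opT_antisym: "q $ 1 = 0 \<Longrightarrow> opT q x \<bullet> y = - (x \<bullet> opT q y)"
  by (intro inner_antisym linear_opT inner_opT)

text \<open>The generators are antisymmetric, so they preserve the orthogonal complement of W and
  commute with the orthogonal projection P onto W. By \<open>schur\<close>, P is a scalar, and it
  fixes W.\<close>

lemma irreducible_opS_opT:
  assumes W: "subspace W"
    and S: "\<And>q x. q $ 1 = 0 \<Longrightarrow> x \<in> W \<Longrightarrow> opS q x \<in> W"
    and T: "\<And>q x. q $ 1 = 0 \<Longrightarrow> x \<in> W \<Longrightarrow> opT q x \<in> W"
  shows "W = {0} \<or> W = UNIV"
proof -
  have "\<exists>y. y \<in> W \<and> (\<forall>w\<in>W. (x - y) \<bullet> w = 0)" for x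
  proof -
    obtain y z where "y \<in> span W" "\<And>w. w \<in> span W \<Longrightarrow> orthogonal z w" "x = y + z"
      using orthogonal_subspace_decomp_exists[of W x] by blast
    then show ?thesis
      using W by (intro exI[of _ y]) (auto simp: span_eq_iff[THEN iffD2] orthogonal_def)
  qed
  then obtain P where P: "\<And>x. P x \<in> W" "\<And>x w. w \<in> W \<Longrightarrow> (x - P x) \<bullet> w = 0" by metis
  \<comment> \<open>This characterization of the projection gives its linearity and its commutation
    with the generators alike.\<close>
  have P_eqI: "P x = y" if "y \<in> W" "\<And>w. w \<in> W \<Longrightarrow> (x - y) \<bullet> w = 0" for x y
  proof -
    have "P x - y \<in> W" using P that W by (simp add: subspace_diff)
    then have "(x - y) \<bullet> (P x - y) - (x - P x) \<bullet> (P x - y) = 0" using P that by simp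
    then have "(P x - y) \<bullet> (P x - y) = 0" by (simp add: inner_diff_left)
    then show ?thesis by simp
  qed
  have Pi: "P x \<bullet> w = x \<bullet> w" if "w \<in> W" for x w
    using P(2)[OF that] by (simp add: inner_diff_left)
  have "linear P"
  proof (rule linearI)
    show "P (x + y) = P x + P y" for x y
    proof (rule P_eqI)
      show "P x + P y \<in> W" using P(1) W by (simp add: subspace_add)
    qed (simp add: Pi inner_diff_left inner_add_left)
    show "P (c *\<^sub>R x) = c *\<^sub>R P x" for c x
    proof (rule P_eqI)
      show "c *\<^sub>R P x \<in> W" using P(1) W by (simp add: subspace_scale)
    qed (simp add: Pi inner_diff_left)
  qed
  moreover have "P (opS q x) = opS q (P x)" if q: "q $ 1 = 0" for q x
  proof (rule P_eqI)
    show "opS q (P x) \<in> W" using S[OF q] P(1) .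
    show "(opS q x - opS q (P x)) \<bullet> w = 0" if "w \<in> W" for w
      using S[OF q that] by (simp add: inner_diff_left opS_antisym[OF q] Pi)
  qed
  moreover have "P (opT q x) = opT q (P x)" if q: "q $ 1 = 0" for q x
  proof (rule P_eqI)
    show "opT q (P x) \<in> W" using T[OF q] P(1) .
    show "(opT q x - opT q (P x)) \<bullet> w = 0" if "w \<in> W" for w
      using T[OF q that] by (simp add: inner_diff_left opT_antisym[OF q] Pi)
  qed
  ultimately obtain c where c: "\<And>x. P x = c *\<^sub>R x" using schur[of P] by blast
  show ?thesis
  proof (cases "W = {0}")
    case False
    then obtain w where w: "w \<in> W" "w \<noteq> 0" using subspace_0[OF W] by blast
    then have "P w = w" by (intro P_eqI) simp_all
    then have "(c - 1) *\<^sub>R w = 0" by (simp add: c scaleR_left_diff_distrib)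
    then have "c = 1" using w by simp
    then have "x \<in> W" for x using P(1)[of x] by (simp add: c)
    then show ?thesis by blast
  qed simp
qed

text \<open>Invariance under the group yields invariance under the generators without a limit:
  homogeneity passes from unit to arbitrary quaternions, and \<open>opT_gact\<close> is a finite
  difference.\<close>

lemma irreducible_gact:
  assumes W: "subspace W"
    and G: "\<And>p q x. p \<bullet> p = 1 \<Longrightarrow> q \<bullet> q = 1 \<Longrightarrow> x \<in> W \<Longrightarrow> gact p q x \<in> W"
  shows "W = {0} \<or> W = UNIV"
proof -
  have unit: "\<exists>c r. p = c *\<^sub>R r \<and> r \<bullet> r = 1" for p :: "real^4"
  proof (cases "p = 0")
    case True
    then show ?thesis by (intro exI[of _ 0] exI[of _ qi]) (simp add: imag_units)
  next
    case False
    then show ?thesis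
      by (intro exI[of _ "norm p"] exI[of _ "inverse (norm p) *\<^sub>R p"]) (simp add: dot_square_norm power2_eq_square)
  qed
  have G': "gact p q x \<in> W" if "x \<in> W" for p q x
    using unit[of p] unit[of q] G[OF _ _ that] W by (auto simp: gact_scale subspace_scale)
  have "opT q x \<in> W" if "q $ 1 = 0" "x \<in> W" for q x
  proof -
    have "6 *\<^sub>R opT q x \<in> W"
      unfolding opT_gact[OF that(1)] using W G'[OF that(2)] by (intro subspace_diff)
    then have "(1/6) *\<^sub>R 6 *\<^sub>R opT q x \<in> W" using W subspace_scale by blast
    then show ?thesis by simp
  qed
  then show ?thesis
    using W G' by (intro irreducible_opS_opT) (auto simp: opS_gact)
qed

section \<open>The stabilizer\<close>

lemma opS_opS: "opS p (opS q x) = opS (qmul p q) x"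
  by (simp add: opS_gact gact_gact)

lemma opS_inject:
  assumes "\<And>x. opS p x = opS q x"
  shows "p = q"
proof -
  have "alpha (axis 1 1) ** transpose (QL p) = alpha (axis 1 1) ** transpose (QL q)"
    using assms by (metis alpha_opS)
  then show ?thesis
    by (simp add: mat_simps alpha_def QL_def axis_def)
qed

lemma opS_minus: "opS (- p) x = - opS p x"
  by (simp add: inj_alpha[symmetric] alpha_opS linear_neg[OF linear_alpha] QL_minus transpose_minus matrix_mul_minus)

lemma opS_qone: "opS qone x = x"
  by (simp add: inj_alpha[symmetric] alpha_opS QL_one)

lemma r3_commutator:
  "p $ 1 = 0 \<Longrightarrow> q $ 1 = 0 \<Longrightarrow> r3 p ** r3 q - r3 q ** r3 p = r3 (qmul p q - qmul q p)"
  by (simp add: mat_simps r3_def qmul_def algebra_simps)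

lemma qmul_commutator_imag: "(qmul p q - qmul q p) $ 1 = 0"
  by (simp add: qmul_def)

lemma QR_diff: "QR (p - q) = QR p - QR q"
  using linear_diff[OF linear_QR] .

lemma opT_commutator:
  assumes "p $ 1 = 0" "q $ 1 = 0"
  shows "opT p (opT q x) - opT q (opT p x) = opT (qmul p q - qmul q p) x"
proof -
  have "alpha (opT p (opT q x) - opT q (opT p x)) =
    (r3 p ** r3 q - r3 q ** r3 p) ** alpha x + alpha x ** transpose (QR p ** QR q - QR q ** QR p)"
    by (simp add: linear_diff[OF linear_alpha] alpha_opT assms matrix_transpose_mul transpose_diff matrix_diff_distrib
        matrix_add_distrib_right matrix_add_ldistrib matrix_mul_assoc)
  then show ?thesis
    using qmul_commutator_imag[of p q]
    by (simp add: inj_alpha[symmetric] alpha_opT r3_commutator assms QR_mult QR_diff)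
qed

lemma opS_opT_commute: "q $ 1 = 0 \<Longrightarrow> opS p (opT q x) = opT q (opS p x)"
proof -
  assume q: "q $ 1 = 0"
  have "transpose (QR q) ** transpose (QL p) = transpose (QL p) ** transpose (QR q)"
    using QL_QR_commute[of p q] by (metis matrix_transpose_mul)
  then have "alpha x ** transpose (QR q) ** transpose (QL p) = alpha x ** transpose (QL p) ** transpose (QR q)"
    by (simp flip: matrix_mul_assoc)
  then show ?thesis
    by (simp add: inj_alpha[symmetric] alpha_opT q alpha_opS matrix_add_distrib_right matrix_mul_assoc)
qed

lemma opS_opT_independent:
  assumes "v $ 1 = 0" "w $ 1 = 0" "\<And>x. opS v x + opT w x = 0"
  shows "v = 0" "w = 0"
proof -
  have "scl (lie_mat v w *v axis k 1) = scl 0" for k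
    using assms(3)[of "scl (axis k 1)"] opS_opT_scl[OF assms(1,2)] by (simp add: linear_0[OF linear_scl])
  then have "lie_mat v w *v axis k 1 = 0" for k
    by (simp only: scl_inject)
  then have "lie_mat v w $ i $ k = 0" for i k
    by (metis matrix_vector_mult_basis column_def vec_lambda_beta zero_index)
  from this[of 1 3] this[of 1 4] this[of 1 5] this[of 1 6] this[of 1 7] this[of 2 7] assms(1,2)
  show "v = 0" "w = 0"
    by (simp_all add: vec_eq_iff forall_4 lie_mat_def)
qed

text \<open>The eigenvalues of the operator are i times the sums of |v| or -|v| with one of |w|,
  -|w|, 3|w|, -3|w|. If all are i or -i, then |v| + |w| = 1 = |v| + 3|w|, so w = 0. The proof
  obtains this from entries of the squared matrix.\<close>

lemma complex_structure_opS:
  assumes vw: "v $ 1 = 0" "w $ 1 = 0" and sq: "\<And>x. opS v (opS v x + opT w x) + opT w (opS v x + opT w x) = - x"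
  shows "w = 0"
proof -
  have "scl (lie_mat v w *v (lie_mat v w *v u)) = scl (- u)" for u
    using sq[of "scl u"] by (simp add: opS_opT_scl[OF vw] linear_neg[OF linear_scl])
  then have "lie_mat v w *v (lie_mat v w *v u) = - u" for u
    by (simp only: scl_inject)
  then have "column j (lie_mat v w ** lie_mat v w) = - axis j 1" for j
    by (simp add: matrix_vector_mul_assoc flip: matrix_vector_mult_basis)
  then have "(lie_mat v w ** lie_mat v w) $ i $ j = (- axis j 1) $ i" for i j
    by (metis column_def vec_lambda_beta)
  then have E: "(\<Sum>k\<in>UNIV. lie_mat v w $ i $ k * lie_mat v w $ k $ j) = (if i = j then - 1 else 0)" for i j
    by (simp add: matrix_matrix_mult_def axis_def)
  define a b c x y z where "a = v$2" and "b = v$3" and "c = v$4" and "x = w$2" and "y = w$3" and "z = w$4"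
  note d = a_def[symmetric] b_def[symmetric] c_def[symmetric] x_def[symmetric] y_def[symmetric] z_def[symmetric]
  have e0: "- 5 * (c*y) - b*x + 6 * (x*y) = 0"
    using E[of 1 7] by (simp add: sum_8 lie_mat_def d algebra_simps add_divide_distrib diff_divide_distrib)
  have e1: "3 * (c*y) - 9 * (b*x) + 6 * (x*y) = 0"
    using E[of 1 8] by (simp add: sum_8 lie_mat_def d algebra_simps add_divide_distrib diff_divide_distrib)
  have e2: "c*y + b*x + 2 * (x*y) = 0"
    using E[of 2 7] by (simp add: sum_8 lie_mat_def d algebra_simps add_divide_distrib diff_divide_distrib)
  have e3: "- (b*z) + a*y + 6 * (y*z) = 0"
    using E[of 1 3] by (simp add: sum_8 lie_mat_def d algebra_simps add_divide_distrib diff_divide_distrib)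
  have e4: "3 * (b*z) + 9 * (a*y) + 6 * (y*z) = 0"
    using E[of 1 4] by (simp add: sum_8 lie_mat_def d algebra_simps add_divide_distrib diff_divide_distrib)
  have e5: "3 * (b*z) + a*y - 2 * (y*z) = 0"
    using E[of 2 3] by (simp add: sum_8 lie_mat_def d algebra_simps add_divide_distrib diff_divide_distrib)
  have e6: "c*z - a*x - 6 * (x*z) = 0"
    using E[of 1 5] by (simp add: sum_8 lie_mat_def d algebra_simps add_divide_distrib diff_divide_distrib)
  have e7: "- 3 * (c*z) - 9 * (a*x) - 6 * (x*z) = 0"
    using E[of 1 6] by (simp add: sum_8 lie_mat_def d algebra_simps add_divide_distrib diff_divide_distrib)
  have e8: "3 * (c*z) + a*x - 2 * (x*z) = 0"
    using E[of 2 5] by (simp add: sum_8 lie_mat_def d algebra_simps add_divide_distrib diff_divide_distrib)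
  have e9: "c*x - x*x - b*y + y*y = 0"
    using E[of 1 2] by (simp add: sum_8 lie_mat_def d algebra_simps add_divide_distrib diff_divide_distrib)
  note e = e0 e1 e2 e3 e4 e5 e6 e7 e8 e9
  \<comment> \<open>Each of the triples e0-e2, e3-e5, e6-e8 is a regular linear system in three of
    the nine mixed products. Consequently at most one of x, y, z is nonzero, and diagonal entries
    refute each case.\<close>
  from e have p: "c*y = 0" "b*x = 0" "x*y = 0" "b*z = 0" "a*y = 0" "y*z = 0" "c*z = 0" "a*x = 0" "x*z = 0"
    by linarith+
  have D: "a*a + b*b + c*c - 4*(c*x) - 4*(b*y) + 2*(a*z) + 7*(x*x) + 7*(y*y) + z*z = 1"
    using E[of 1 1] by (simp add: sum_8 lie_mat_def d algebra_simps add_divide_distrib diff_divide_distrib)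
  have D2: "a*a + b*b + c*c - 6*(a*z) + 3*(x*x) + 3*(y*y) + 9*(z*z) = 1"
    using E[of 2 2] by (simp add: sum_8 lie_mat_def d algebra_simps add_divide_distrib diff_divide_distrib)
  have D3: "4 * (\<Sum>k\<in>UNIV. lie_mat v w $ 3 $ k * lie_mat v w $ k $ 3) = - 4"
    "4 * (\<Sum>k\<in>UNIV. lie_mat v w $ 5 $ k * lie_mat v w $ k $ 5) = - 4"
    "4 * (\<Sum>k\<in>UNIV. lie_mat v w $ 7 $ k * lie_mat v w $ k $ 7) = - 4"
    by (simp_all add: E)
  have "x = 0"
  proof (rule ccontr)
    assume "x \<noteq> 0"
    then have "a = 0" "b = 0" "y = 0" "z = 0" "c = x" using p e(10) by auto
    then show False using D3(2) by (simp add: sum_8 lie_mat_def d)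
  qed
  moreover have "y = 0"
  proof (rule ccontr)
    assume "y \<noteq> 0"
    then have *: "a = 0" "c = 0" "x = 0" "z = 0" "b = y" using p e(10) by auto
    then have "12 * (y*y) = 1" using D3(3) by (simp add: sum_8 lie_mat_def d field_simps)
    then show False using D * by simp
  qed
  moreover have "z = 0"
  proof (rule ccontr)
    assume "z \<noteq> 0"
    then have *: "b = 0" "c = 0" "x = 0" "y = 0" using p by auto
    have "a*a + 2 * (a*z) + z*z = 1" "a*a - 6 * (a*z) + 9 * (z*z) = 1" using D D2 * by simp_all
    then have "a * z = z * z" by linarith
    then have "a = z" using \<open>z \<noteq> 0\<close> by simp
    then have "12 * (z*z) = 1" "4 * (z*z) = 1" using D3(1) D * by (simp_all add: sum_8 lie_mat_def d field_simps)
    then show False by simp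
  qed
  ultimately show ?thesis using vw(2) by (simp add: vec_eq_iff forall_4 d)
qed

section \<open>Inner automorphisms of the quaternions\<close>

lemma linear_qmul: "linear (qmul p)" "linear (\<lambda>p. qmul p q)"
  by (rule linearI; simp add: mat_simps qmul_def algebra_simps)+

lemmas qmul_linear_simps = linear_add[OF linear_qmul(1)] linear_add[OF linear_qmul(2)] linear_diff[OF linear_qmul(1)]
  linear_diff[OF linear_qmul(2)] linear_neg[OF linear_qmul(1)] linear_neg[OF linear_qmul(2)]
  linear_scale[OF linear_qmul(1)] linear_scale[OF linear_qmul(2)]

lemma quaternion_units:
  "qmul qi qi = - qone" "qmul qj qj = - qone" "qmul qk qk = - qone"
  "qmul qi qj = qk" "qmul qj qk = qi" "qmul qk qi = qj" "qmul qj qi = - qk" "qmul qk qj = - qi" "qmul qi qk = - qj"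
  by (simp_all add: mat_simps qmul_def qi_def qj_def qk_def qone_def)

text \<open>The map \<open>x \<mapsto> x - v1 x i - v2 x j - v3 x k\<close> takes values that intertwine the two bases; it has trace 4,
  so it does not vanish.\<close>

lemma quaternion_frame:
  assumes im: "v1 $ 1 = 0" "v2 $ 1 = 0" "v3 $ 1 = 0"
    and v: "qmul v1 v1 = - qone" "qmul v2 v2 = - qone" "qmul v1 v2 = v3"
  obtains p where "p \<bullet> p = 1" "qmul v1 p = qmul p qi" "qmul v2 p = qmul p qj" "qmul v3 p = qmul p qk"
proof -
  \<comment> \<open>Conjugation reverses products and negates imaginary quaternions, so it turns the
    equation for \<open>v3\<close> into this one.\<close>
  have v21: "qmul v2 v1 = - v3"
    using im v(3) by (simp add: mat_simps qmul_def algebra_simps)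
  have V: "qmul v1 (qmul v1 y) = - y" "qmul v2 (qmul v2 y) = - y" "qmul v1 (qmul v2 y) = qmul v3 y"
    "qmul v2 (qmul v1 y) = - qmul v3 y" for y
    by (simp_all add: v v21 qmul_linear_simps flip: qmul_assoc)
  have V': "qmul v1 (qmul v3 y) = - qmul v2 y" "qmul v2 (qmul v3 y) = qmul v1 y" for y
  proof -
    show "qmul v1 (qmul v3 y) = - qmul v2 y"
      using V(1)[of "qmul v2 y"] by (simp only: V(3))
    have "qmul v3 y = - qmul v2 (qmul v1 y)"
      by (simp add: V(4))
    then show "qmul v2 (qmul v3 y) = qmul v1 y"
      by (simp only: qmul_linear_simps V(2) minus_minus)
  qed
  define g where "g x = x - qmul v1 (qmul x qi) - qmul v2 (qmul x qj) - qmul v3 (qmul x qk)" for x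
  have g: "qmul v1 (g x) = qmul (g x) qi" "qmul v2 (g x) = qmul (g x) qj" for x
    by (simp_all add: g_def qmul_linear_simps V V' qmul_assoc quaternion_units)
  have "g qone $ 1 + g qi $ 2 + g qj $ 3 + g qk $ 4 = 4"
    using im by (simp add: g_def qmul_def qone_def qi_def qj_def qk_def)
  then obtain x where x: "g x \<noteq> 0"
    by (metis add_0 zero_index zero_neq_numeral)
  define p where "p = inverse (norm (g x)) *\<^sub>R g x"
  have "p \<bullet> p = 1"
    using x by (simp add: p_def dot_square_norm power2_eq_square)
  moreover have p: "qmul v1 p = qmul p qi" "qmul v2 p = qmul p qj"
    by (simp_all add: p_def qmul_linear_simps g)
  moreover have "qmul v3 p = qmul p qk"
    by (metis p qmul_assoc quaternion_units(4) v(3))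
  ultimately show thesis by (rule that)
qed

text \<open>A commutator is orthogonal to its factors, so the brackets make the three quaternions
  orthogonal and the products pure. Norms multiply, whence AB = C, BC = A, CA = B for the squared
  norms; with A > 0 all are 1.\<close>

lemma quaternion_triple_of_commutators:
  assumes im: "w1 $ 1 = 0" "w2 $ 1 = 0" "w3 $ 1 = 0"
    and c: "qmul w1 w2 - qmul w2 w1 = 2 *\<^sub>R w3" "qmul w2 w3 - qmul w3 w2 = 2 *\<^sub>R w1" "qmul w3 w1 - qmul w1 w3 = 2 *\<^sub>R w2"
    and nz: "w1 \<noteq> 0"
  shows "qmul w1 w1 = - qone" "qmul w2 w2 = - qone" "qmul w1 w2 = w3"
proof -
  have x: "qmul v w = - (v \<bullet> w) *\<^sub>R qone + (1/2) *\<^sub>R (qmul v w - qmul w v)" if "v $ 1 = 0" "w $ 1 = 0" for v w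
    using that by (simp add: mat_simps qmul_def qone_def inner_vec_def algebra_simps)
  have m: "qmul w1 w2 = - (w1 \<bullet> w2) *\<^sub>R qone + w3" "qmul w2 w3 = - (w2 \<bullet> w3) *\<^sub>R qone + w1"
    "qmul w3 w1 = - (w3 \<bullet> w1) *\<^sub>R qone + w2"
    using x[OF im(1,2)] x[OF im(2,3)] x[OF im(3,1)] c by simp_all
  have perp: "v \<bullet> (qmul v w - qmul w v) = 0" if "v $ 1 = 0" "w $ 1 = 0" for v w
    using that by (simp add: qmul_def inner_vec_def sum_4 algebra_simps)
  have o: "w1 \<bullet> w2 = 0" "w2 \<bullet> w3 = 0" "w3 \<bullet> w1 = 0"
    using perp[OF im(2,3)] perp[OF im(3,1)] perp[OF im(1,2)] c by (simp_all add: inner_commute)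
  define A B C where "A = w1 \<bullet> w1" and "B = w2 \<bullet> w2" and "C = w3 \<bullet> w3"
  have n: "A * B = C" "B * C = A" "C * A = B"
    using inner_qmul[of w1 w2] inner_qmul[of w2 w3] inner_qmul[of w3 w1]
    by (simp_all add: A_def B_def C_def m o)
  have pos: "A > 0" "B \<ge> 0" "C \<ge> 0" using nz by (simp_all add: A_def B_def C_def)
  have "A * (B * B) = A * 1" using n by (simp add: mult.assoc[symmetric] mult.commute)
  then have "B * B = 1" using pos by simp
  then have "B = 1" using pos by (simp add: power2_eq_1_iff flip: power2_eq_square)
  then have "A * A = 1" using n by simp
  then have "A = 1" using pos by (simp add: power2_eq_1_iff flip: power2_eq_square)
  show "qmul w1 w1 = - qone" "qmul w2 w2 = - qone" "qmul w1 w2 = w3"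
    using x[OF im(1,1)] x[OF im(2,2)] \<open>A = 1\<close> \<open>B = 1\<close> m o by (simp_all add: A_def B_def)
qed

section \<open>Invariance of F under the group\<close>

lemma dF_invariant:
  assumes "linear a" "\<And>x. F (a x) = F x"
  shows "dF (a x) (a v) = dF x v"
proof -
  have "F (a x + t *\<^sub>R a v) = F (x + t *\<^sub>R v)" for t
    by (metis assms linear_add linear_scale)
  then show ?thesis
    using DERIV_F[of "a x" "a v"] DERIV_F[of x v] by (simp add: DERIV_unique)
qed

lemma qmul_qconj_unit: "q \<bullet> q = 1 \<Longrightarrow> qmul q (qconj q) = qone" "q \<bullet> q = 1 \<Longrightarrow> qmul (qconj q) q = qone"
  by (simp_all add: qmul_qconj)

lemma R3_unit: "q \<bullet> q = 1 \<Longrightarrow> R3 q ** transpose (R3 q) = mat 1" "q \<bullet> q = 1 \<Longrightarrow> transpose (R3 q) ** R3 q = mat 1"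
  by (simp_all add: transpose_R3 R3_mult qmul_qconj_unit R3_one)

lemma gram_gact:
  assumes "p \<bullet> p = 1" "q \<bullet> q = 1"
  shows "gram (gact p q x) = R3 q ** gram x ** transpose (R3 q)"
proof -
  define X where "X = QL p ** QR q"
  have "transpose X ** X = (QL (qconj p) ** QR (qconj q)) ** (QL p ** QR q)"
    by (simp add: X_def matrix_transpose_mul transpose_QL transpose_QR QL_QR_commute)
  also have "\<dots> = mat 1"
    by (simp only: QL_QR_mult qmul_qconj_unit assms QL_one QR_one matrix_mul_lid)
  finally have X: "transpose X ** X = mat 1" .
  have a: "alpha (gact p q x) = R3 q ** alpha x ** transpose X"
    by (simp add: alpha_gact X_def)
  have "gram (gact p q x) = R3 q ** alpha x ** (transpose X ** X) ** transpose (alpha x) ** transpose (R3 q)"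
    unfolding gram_def a matrix_transpose_mul transpose_transpose by (simp only: matrix_mul_assoc)
  then show ?thesis
    unfolding X by (simp add: gram_def matrix_mul_assoc)
qed

lemma trace_gram: "trace (gram x) = 6 * (x \<bullet> x)"
  using sum_squares_alpha[of x x] by (simp add: trace_def gram_def matrix_matrix_mult_def transpose_def)

lemma inner_gact:
  assumes "p \<bullet> p = 1" "q \<bullet> q = 1"
  shows "gact p q x \<bullet> gact p q x = x \<bullet> x"
proof -
  have "trace (gram (gact p q x)) = trace (transpose (R3 q) ** R3 q ** gram x)"
    unfolding gram_gact[OF assms] by (metis trace_mul_sym matrix_mul_assoc)
  then show ?thesis
    using trace_gram[of x] trace_gram[of "gact p q x"] by (simp add: R3_unit assms)
qed

lemma F_gact:
  assumes "p \<bullet> p = 1" "q \<bullet> q = 1"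
  shows "F (gact p q x) = F x"
proof -
  have d: "det (R3 q) * det (R3 q) = 1"
    using arg_cong[OF R3_unit(1)[OF assms(2)], of det] by (simp add: det_mul)
  have "det (gram (gact p q x)) = (det (R3 q) * det (R3 q)) * det (gram x)"
    by (simp add: gram_gact assms det_mul)
  then have "det (gram (gact p q x)) = det (gram x)"
    by (simp add: d)
  then show ?thesis by (simp add: F_eq inner_gact assms)
qed

lemma F_scaleR: "F (c *\<^sub>R x) = c ^ 6 * F x"
proof -
  have "gram (c *\<^sub>R x) = c\<^sup>2 *\<^sub>R gram x"
    by (simp add: gram_def linear_scale[OF linear_alpha] transpose_scalar matrix_scalar_ac
        scalar_matrix_assoc[symmetric] power2_eq_square)
  then have "det (gram (c *\<^sub>R x)) = c ^ 6 * det (gram x)"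
    by (simp add: det_3 eval_nat_numeral algebra_simps)
  then show ?thesis
    by (simp add: F_eq eval_nat_numeral algebra_simps)
qed

lemma F_nonzero: "F (axis 1 1) \<noteq> 0"
  by (simp add: F_eq gram_def det_3 mat_simps alpha_def axis_def inner_vec_def sum_8)

lemma opT_scale: "q $ 1 = 0 \<Longrightarrow> opT (c *\<^sub>R q) x = c *\<^sub>R opT q x"
  and opT_diff: "p $ 1 = 0 \<Longrightarrow> q $ 1 = 0 \<Longrightarrow> opT (p - q) x = opT p x - opT q x"
proof -
  have r: "r3 (c *\<^sub>R q) = c *\<^sub>R r3 q" "r3 (p - q) = r3 p - r3 q" for p q
    by (simp_all add: r3_def mat_simps)
  show "q $ 1 = 0 \<Longrightarrow> opT (c *\<^sub>R q) x = c *\<^sub>R opT q x"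
    by (simp add: inj_alpha[symmetric] alpha_opT linear_scale[OF linear_alpha] r linear_scale[OF linear_QR]
        transpose_scalar matrix_scalar_ac scalar_matrix_assoc[symmetric] scaleR_right_distrib)
  show "p $ 1 = 0 \<Longrightarrow> q $ 1 = 0 \<Longrightarrow> opT (p - q) x = opT p x - opT q x"
    by (simp add: inj_alpha[symmetric] alpha_opT linear_diff[OF linear_alpha] r QR_diff transpose_diff matrix_diff_distrib)
qed

lemma opS_zero: "opS 0 x = 0" and opT_zero: "opT 0 x = 0"
  using opT_scale[of 0 0 x]
  by (simp_all add: inj_alpha[symmetric] alpha_opS QL_zero linear_0[OF linear_alpha] transpose_def zero_vec_def[symmetric])

lemma opT_inject:
  assumes "p $ 1 = 0" "q $ 1 = 0" "\<And>x. opT p x = opT q x"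
  shows "p = q"
proof -
  have "opS 0 x + opT (p - q) x = 0" for x
    using assms by (simp add: opT_diff opS_zero)
  then show ?thesis
    using opS_opT_independent(2)[of 0 "p - q"] assms by simp
qed

lemma opT_gact_intertwine:
  assumes "e $ 1 = 0" "w $ 1 = 0" "qmul w q = qmul q e"
  shows "opT w (gact qone q x) = gact qone q (opT e x)"
proof -
  \<comment> \<open>Both \<open>qone + w\<close> and w satisfy the intertwining relation with q; the
    difference of the two \<open>R3\<close> identities isolates \<open>r3\<close>.\<close>
  have "R3 (qone + w) ** R3 q = R3 q ** R3 (qone + e)" "R3 w ** R3 q = R3 q ** R3 e"
    by (simp_all add: R3_mult qmul_linear_simps assms)
  then have r: "r3 w ** R3 q = R3 q ** r3 e"
    by (simp add: R3_polarize assms R3_one matrix_add_distrib_right matrix_add_ldistrib)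
  have "transpose (QR q) ** transpose (QR w) = transpose (QR e) ** transpose (QR q)"
    by (simp add: QR_mult assms flip: matrix_transpose_mul)
  then have "Y ** transpose (QR q) ** transpose (QR w) = Y ** transpose (QR e) ** transpose (QR q)" for Y :: "real^4^3"
    by (simp flip: matrix_mul_assoc)
  then show ?thesis
    by (simp add: inj_alpha[symmetric] alpha_gact alpha_opT assms QL_one matrix_add_distrib_right matrix_add_ldistrib
        matrix_mul_assoc r)
qed

lemma opS_basis: "q $ 1 = 0 \<Longrightarrow> opS q x = q$2 *\<^sub>R opS qi x + q$3 *\<^sub>R opS qj x + q$4 *\<^sub>R opS qk x"
  by (simp add: inj_alpha[symmetric] alpha_opS linear_add[OF linear_alpha] linear_scale[OF linear_alpha])
     (simp add: mat_simps QL_def qi_def qj_def qk_def)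

lemma opT_basis: "q $ 1 = 0 \<Longrightarrow> opT q x = q$2 *\<^sub>R opT qi x + q$3 *\<^sub>R opT qj x + q$4 *\<^sub>R opT qk x"
  by (simp add: inj_alpha[symmetric] alpha_opT imag_units linear_add[OF linear_alpha] linear_scale[OF linear_alpha])
     (simp add: mat_simps QR_def r3_def qi_def qj_def qk_def algebra_simps)

section \<open>Reduction of an arbitrary automorphism of F to a group element\<close>

lemma lie_algebra_conj:
  assumes lin: "linear a" "linear a'" and inv: "\<And>x. a (a' x) = x" and F: "\<And>x. F (a x) = F x"
    and f: "linear f" "\<And>x. dF x (f x) = 0"
  obtains v w where "v $ 1 = 0" "w $ 1 = 0" "\<And>x. a (f (a' x)) = opS v x + opT w x"
proof -
  have "linear (\<lambda>x. a (f (a' x)))"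
    using linear_compose[OF lin(2) linear_compose[OF f(1) lin(1)]] by (simp add: o_def)
  moreover have "dF x (a (f (a' x))) = 0" for x
    using dF_invariant[OF lin(1) F, of "a' x" "f (a' x)"] by (simp add: inv f(2))
  ultimately show thesis using lie_algebra_of_F that by metis
qed

lemma opS_conj:
  assumes lin: "linear a" "linear a'" and inv: "\<And>x. a (a' x) = x" "\<And>x. a' (a x) = x" and F: "\<And>x. F (a x) = F x"
    and e: "e $ 1 = 0" "e \<bullet> e = 1"
  obtains v where "v $ 1 = 0" "\<And>x. a (opS e (a' x)) = opS v x"
proof -
  obtain v w where vw: "v $ 1 = 0" "w $ 1 = 0" and L: "\<And>x. a (opS e (a' x)) = opS v x + opT w x"
    using lie_algebra_conj[OF lin inv(1) F linear_opS dF_opS[OF e(1)]] by blast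
  have "a (opS e (a' (a (opS e (a' x))))) = - x" for x
    by (simp add: inv opS_opS qmul_imag e opS_minus opS_qone linear_neg[OF lin(1)])
  then have "w = 0"
    using complex_structure_opS[OF vw] unfolding L by blast
  then show thesis using that vw L by (simp add: opT_zero)
qed

lemma stabilizer_gact:
  assumes lin: "linear a" "linear a'" and inv: "\<And>x. a (a' x) = x" "\<And>x. a' (a x) = x" and F: "\<And>x. F (a x) = F x"
  obtains p q where "p \<bullet> p = 1" "q \<bullet> q = 1" "\<And>x. a x = gact p q x"
proof -
  note conj = opS_conj[OF lin inv F]
  obtain v1 v2 v3 where v: "v1 $ 1 = 0" "v2 $ 1 = 0" "v3 $ 1 = 0"
    and V: "\<And>x. a (opS qi (a' x)) = opS v1 x" "\<And>x. a (opS qj (a' x)) = opS v2 x" "\<And>x. a (opS qk (a' x)) = opS v3 x"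
    using conj[OF imag_units(1,4)] conj[OF imag_units(2,5)] conj[OF imag_units(3,6)] by metis
  \<comment> \<open>Composition of \<open>opS\<close> is quaternion multiplication, so conjugation
    by a carries the relations among i, j, k over to \<open>v1\<close>, \<open>v2\<close>,
    \<open>v3\<close>.\<close>
  have "opS (qmul v1 v1) x = opS (- qone) x" "opS (qmul v2 v2) x = opS (- qone) x" "opS (qmul v1 v2) x = opS v3 x" for x
    by (simp_all add: inv quaternion_units opS_minus opS_qone linear_neg[OF lin(1)]
        flip: opS_opS V)
       (simp_all add: opS_opS quaternion_units opS_minus opS_qone linear_neg[OF lin(1)] inv)
  then have "qmul v1 v1 = - qone" "qmul v2 v2 = - qone" "qmul v1 v2 = v3"
    using opS_inject by blast+
  then obtain p where p: "p \<bullet> p = 1" and vp: "qmul v1 p = qmul p qi" "qmul v2 p = qmul p qj" "qmul v3 p = qmul p qk"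
    using quaternion_frame[OF v] by metis
  \<comment> \<open>Corrects a by an element of the first factor, so that b commutes with every
    \<open>opS\<close>.\<close>
  define b where "b x = opS (qconj p) (a x)" for x
  define b' where "b' x = a' (opS p x)" for x
  have b_inv: "b (b' x) = x" "b' (b x) = x" for x
    by (simp_all add: b_def b'_def inv opS_opS qmul_qconj_unit[OF p] opS_qone)
  have b_lin: "linear b" "linear b'"
    using linear_compose[OF lin(1) linear_opS] linear_compose[OF linear_opS lin(2)]
    by (simp_all add: b_def[abs_def] b'_def[abs_def] o_def)
  have qconj_unit: "qconj r \<bullet> qconj r = 1" if "r \<bullet> r = 1" for r
    using that by (simp add: qconj_def inner_vec_def sum_4)
  have one: "qone \<bullet> qone = 1" by (simp add: qone_def inner_vec_def sum_4)
  have b_F: "F (b x) = F x" for x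
    by (simp add: b_def opS_gact F_gact qconj_unit p one F)
  have bS0: "b (opS e (b' x)) = opS e x" if "\<And>x. a (opS e (a' x)) = opS u x" "qmul u p = qmul p e" for e u x
  proof -
    have "qmul (qconj p) (qmul u p) = e"
      unfolding that(2) by (simp add: qmul_qconj_unit[OF p] flip: qmul_assoc)
    then show ?thesis
      by (simp add: b_def b'_def that(1) opS_opS qmul_assoc)
  qed
  have bS: "b (opS e x) = opS e (b x)" if "e \<in> {qi, qj, qk}" for e x
    using that bS0[OF V(1) vp(1), of "b x"] bS0[OF V(2) vp(2), of "b x"] bS0[OF V(3) vp(3), of "b x"]
    by (auto simp: b_inv)
  have b'S: "b' (opS e x) = opS e (b' x)" if "e \<in> {qi, qj, qk}" for e x
    by (metis bS[OF that] b_inv)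
  have "\<exists>w. w $ 1 = 0 \<and> (\<forall>x. b (opT e (b' x)) = opT w x)" if e: "e $ 1 = 0" for e
  proof -
    obtain v w where vw: "v $ 1 = 0" "w $ 1 = 0" and L: "\<And>x. b (opT e (b' x)) = opS v x + opT w x"
      using lie_algebra_conj[OF b_lin b_inv(1) b_F linear_opT dF_opT[OF e]] by blast
    \<comment> \<open>The conjugate of \<open>opT e\<close> commutes with \<open>opS u\<close> for u
      = i, j, k, and so does \<open>opT w\<close>. Hence v commutes with these units, which forces
      an imaginary v to vanish.\<close>
    have "qmul v u = qmul u v" if u: "u \<in> {qi, qj, qk}" for u
    proof (rule opS_inject)
      fix x
      have "b (opT e (b' (opS u x))) = opS u (b (opT e (b' x)))"
        by (simp add: b'S[OF u] bS[OF u] opS_opT_commute[OF e, symmetric])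
      then show "opS (qmul v u) x = opS (qmul u v) x"
        by (simp add: L linear_add[OF linear_opS] opS_opT_commute[OF vw(2)] opS_opS)
    qed
    from this[of qi] this[of qj] have "v = 0"
      using vw(1) by (simp add: mat_simps qmul_def qi_def qj_def)
    then show ?thesis using vw(2) L by (auto simp: opS_zero)
  qed
  then obtain w1 w2 w3 where w: "w1 $ 1 = 0" "w2 $ 1 = 0" "w3 $ 1 = 0"
    and W: "\<And>x. b (opT qi (b' x)) = opT w1 x" "\<And>x. b (opT qj (b' x)) = opT w2 x" "\<And>x. b (opT qk (b' x)) = opT w3 x"
    by (metis imag_units(1,2,3))
  \<comment> \<open>Composition of \<open>opT\<close> is not quaternion multiplication, so only
    brackets can be transported; the factor 2 comes from [i, j] = 2k.\<close>
  have comm: "qmul u u' - qmul u' u = 2 *\<^sub>R u''"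
    if "u $ 1 = 0" "u' $ 1 = 0" "u'' $ 1 = 0" "e $ 1 = 0" "e' $ 1 = 0" "e'' $ 1 = 0"
      and U: "\<And>x. b (opT e (b' x)) = opT u x" "\<And>x. b (opT e' (b' x)) = opT u' x" "\<And>x. b (opT e'' (b' x)) = opT u'' x"
      and ee: "qmul e e' - qmul e' e = 2 *\<^sub>R e''" for u u' u'' e e' e''
  proof (rule opT_inject)
    fix x
    have "opT (qmul u u' - qmul u' u) x = b (opT e (opT e' (b' x)) - opT e' (opT e (b' x)))"
      unfolding opT_commutator[OF that(1,2), symmetric] U[symmetric] by (simp add: b_inv linear_diff[OF b_lin(1)])
    also have "\<dots> = opT (2 *\<^sub>R u'') x"
      by (simp add: opT_commutator that ee opT_scale linear_scale[OF b_lin(1)] U)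
    finally show "opT (qmul u u' - qmul u' u) x = opT (2 *\<^sub>R u'') x" .
  qed (use that qmul_commutator_imag[of u u'] in simp_all)
  have "w1 \<noteq> 0"
  proof
    assume "w1 = 0"
    then have "b (opT qi (b' (b x))) = b 0" for x
      by (simp only: W opT_zero linear_0[OF b_lin(1)])
    then have "opT qi x = opT 0 x" for x
      by (metis b_inv(2) opT_zero)
    then have "qi = 0" by (intro opT_inject) (simp_all add: imag_units)
    then show False by (simp add: qi_def vec_eq_iff forall_4)
  qed
  moreover have "qmul w1 w2 - qmul w2 w1 = 2 *\<^sub>R w3" "qmul w2 w3 - qmul w3 w2 = 2 *\<^sub>R w1" "qmul w3 w1 - qmul w1 w3 = 2 *\<^sub>R w2"
    by (rule comm[OF w(1,2,3) imag_units(1,2,3) W(1,2,3)] comm[OF w(2,3,1) imag_units(2,3,1) W(2,3,1)]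
        comm[OF w(3,1,2) imag_units(3,1,2) W(3,1,2)]; simp add: quaternion_units scaleR_2)+
  ultimately have "qmul w1 w1 = - qone" "qmul w2 w2 = - qone" "qmul w1 w2 = w3"
    using quaternion_triple_of_commutators[OF w] by blast+
  then obtain q where q: "q \<bullet> q = 1" and wq: "qmul w1 q = qmul q qi" "qmul w2 q = qmul q qj" "qmul w3 q = qmul q qk"
    using quaternion_frame[OF w] by metis
  \<comment> \<open>Corrects b by an element of the second factor; c then commutes with both
    families of generators.\<close>
  define c where "c x = gact qone (qconj q) (b x)" for x
  have gq: "gact qone q (gact qone (qconj q) x) = x" "gact qone (qconj q) (gact qone q x) = x" for x
    by (simp_all add: gact_gact qmul_qconj_unit[OF q]) (simp_all add: opS_qone flip: opS_gact)
  have c_lin: "linear c"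
    using linear_compose[OF b_lin(1) linear_gact] by (simp add: c_def[abs_def] o_def)
  have c_F: "F (c x) = F x" for x
    by (simp add: c_def F_gact qconj_unit q one b_F)
  have cS: "c (opS e x) = opS e (c x)" if "e \<in> {qi, qj, qk}" for e x
    by (simp add: c_def bS[OF that]) (simp add: opS_gact gact_gact)
  have cT0: "c (opT e x) = opT e (c x)"
    if "e $ 1 = 0" "w $ 1 = 0" "\<And>x. b (opT e (b' x)) = opT w x" "qmul w q = qmul q e" for e w x
  proof -
    have "b (opT e x) = opT w (gact qone q (c x))"
      using that(3)[of "b x"] by (simp add: b_inv c_def gq)
    then have "b (opT e x) = gact qone q (opT e (c x))"
      by (simp add: opT_gact_intertwine[OF that(1,2,4)])
    then show ?thesis by (simp add: c_def[of "opT e x"] gq)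
  qed
  note cT = cT0[OF imag_units(1) w(1) W(1) wq(1)] cT0[OF imag_units(2) w(2) W(2) wq(2)] cT0[OF imag_units(3) w(3) W(3) wq(3)]
  obtain k where k: "\<And>x. c x = k *\<^sub>R x"
  proof (rule schur[OF c_lin])
    show "c (opS r x) = opS r (c x)" if "r $ 1 = 0" for r x
      unfolding opS_basis[OF that] by (simp add: linear_add[OF c_lin] linear_scale[OF c_lin] cS)
    show "c (opT r x) = opT r (c x)" if "r $ 1 = 0" for r x
      unfolding opT_basis[OF that] by (simp add: linear_add[OF c_lin] linear_scale[OF c_lin] cT)
  qed blast
  have "k ^ 6 = 1"
    using c_F[of "axis 1 1"] F_nonzero by (simp add: k F_scaleR)
  then have "\<bar>k\<bar> = 1"
    using power_eq_1_iff[of k 6] by simp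
  then have k2: "k * k = 1" by (metis abs_mult_self_eq mult_1_right)
  \<comment> \<open>The sign k is moved into the first quaternion, which remains a unit.\<close>
  have ax: "a x = gact (k *\<^sub>R p) q x" for x
  proof -
    have "b x = gact qone q (k *\<^sub>R x)"
      using gq(1)[of "b x"] by (simp add: k flip: c_def)
    then have "opS p (b x) = k *\<^sub>R gact p q x"
      by (simp add: opS_gact gact_gact linear_scale[OF linear_gact])
    moreover have "opS p (b x) = a x"
      by (simp add: b_def opS_opS qmul_qconj_unit[OF p] opS_qone)
    ultimately show ?thesis
      using gact_scale[of k p 1 q x] by simp
  qed
  show thesis
  proof (rule that[OF _ q ax])
    show "(k *\<^sub>R p) \<bullet> (k *\<^sub>R p) = 1" using p k2 by simp
  qed
qed

text \<open>A root of q is the normalized bisector of 1 and q, because (1 + q)^2 = 2 (1 + Re q) q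
  for unit q. This degenerates only at q = -1, the square of i.\<close>

lemma quaternion_sqrt:
  assumes "q \<bullet> q = 1"
  obtains r where "r \<bullet> r = 1" "qmul r r = q"
proof (cases "q = - qone")
  case True
  then show ?thesis using that[of qi] by (simp add: imag_units quaternion_units)
next
  case False
  have n: "q$1 * q$1 + q$2 * q$2 + q$3 * q$3 + q$4 * q$4 = 1"
    using assms by (simp add: inner_vec_def sum_4)
  let ?s = "qone + q"
  have "?s \<noteq> 0" using False by (metis add_eq_0_iff)
  then have pos: "?s \<bullet> ?s > 0" by simp
  have i: "?s \<bullet> ?s = 2 + 2 * q$1"
    using n by (simp add: inner_vec_def sum_4 qone_def algebra_simps)
  have sq: "qmul ?s ?s = (?s \<bullet> ?s) *\<^sub>R q"
    unfolding i using n by (simp add: mat_simps qmul_def qone_def algebra_simps)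
  define c where "c = inverse (sqrt (?s \<bullet> ?s))"
  have c: "c * c * (?s \<bullet> ?s) = 1"
    using pos by (simp add: c_def field_simps)
  show ?thesis
  proof (rule that[of "c *\<^sub>R ?s"])
    show "(c *\<^sub>R ?s) \<bullet> (c *\<^sub>R ?s) = 1" using c by (simp add: mult.assoc)
    show "qmul (c *\<^sub>R ?s) (c *\<^sub>R ?s) = q"
      by (simp only: linear_scale[OF linear_qmul(1)] linear_scale[OF linear_qmul(2)] sq scaleR_scaleR
          mult.assoc[symmetric] c scaleR_one)
  qed
qed

lemma matrix_gact_vec: "matrix (gact p q) *v x = gact p q x"
  using matrix_works[OF linear_gact[unfolded linear_matrix_vector_mul_eq[symmetric]]] linear_gact by (simp add: matrix_works)

lemma matrix_gact_mult: "matrix (gact p q) ** matrix (gact p' q') = matrix (gact (qmul p p') (qmul q q'))"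
  by (simp add: matrix_eq matrix_gact_vec gact_gact flip: matrix_vector_mul_assoc)

text \<open>Every group element is the square of an orthogonal matrix, so its determinant is 1;
  square roots stand in for connectedness.\<close>

lemma matrix_gact_SO8:
  assumes "p \<bullet> p = 1" "q \<bullet> q = 1"
  shows "matrix (gact p q) \<in> SO8"
proof -
  have orth: "orthogonal_matrix (matrix (gact p q))" if "p \<bullet> p = 1" "q \<bullet> q = 1" for p q
  proof -
    have "orthogonal_transformation (gact p q)"
      unfolding orthogonal_transformation by (simp add: linear_gact norm_eq inner_gact that)
    then show ?thesis by (simp add: orthogonal_transformation_matrix)
  qed
  obtain r where r: "r \<bullet> r = 1" "qmul r r = p" using quaternion_sqrt[OF assms(1)] by blast
  obtain s where s: "s \<bullet> s = 1" "qmul s s = q" using quaternion_sqrt[OF assms(2)] by blast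
  have "det (matrix (gact p q)) = det (matrix (gact r s)) * det (matrix (gact r s))"
    by (simp add: matrix_gact_mult r s flip: det_mul)
  then have "det (matrix (gact p q)) = 1"
    using det_orthogonal_matrix[OF orth[OF r(1) s(1)]] by auto
  then show ?thesis using orth assms by (simp add: SO8_def)
qed

section \<open>The tensor, its stabilizer and irreducibility\<close>

lemma Upsilon_unique: "\<exists>!T. symmetric_tensor T \<and> (\<forall>x. tensor_form T x = F x)"
proof -
  obtain T where T: "F = tensor_form T"
    using sextic_form_F unfolding sextic_form_def F_eq[abs_def] gram_def by metis
  obtain T' where "symmetric_tensor T'" "\<And>x. tensor_form T' x = F x"
    using ex_symmetric_tensor[of T] T by metis
  then show ?thesis by (intro ex1I[of _ T']) (auto intro: symmetric_tensor_eqI)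
qed

lemma Upsilon: "symmetric_tensor Upsilon" "tensor_form Upsilon x = F x"
  using theI'[OF Upsilon_unique] unfolding Upsilon_def by auto

text \<open>A symmetric tensor is determined by its form and pull-back preserves symmetry, so
  stabilizing the tensor amounts to preserving F.\<close>

lemma stabilizer_Upsilon: "stabilizer Upsilon = {A. invertible A \<and> (\<forall>x. F (A *v x) = F x)}"
proof -
  have "pullback A Upsilon = Upsilon \<longleftrightarrow> (\<forall>x. F (A *v x) = F x)" for A
  proof
    assume "pullback A Upsilon = Upsilon"
    then show "\<forall>x. F (A *v x) = F x" by (metis Upsilon(2) tensor_form_pullback)
  next
    assume "\<forall>x. F (A *v x) = F x"
    then show "pullback A Upsilon = Upsilon"
      by (intro symmetric_tensor_eqI symmetric_tensor_pullback Upsilon) (simp add: tensor_form_pullback Upsilon)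
  qed
  then show ?thesis by (simp add: stabilizer_def)
qed

lemma rho_H7: "rho ` H7 = {matrix (gact p q) | p q. p \<bullet> p = 1 \<and> q \<bullet> q = 1}"
  unfolding H7_eq using rho_K7 by (auto simp: image_iff) metis+

lemma stabilizer_eq: "stabilizer Upsilon = rho ` H7"
proof (intro equalityI subsetI)
  fix A assume "A \<in> stabilizer Upsilon"
  then have A: "invertible A" "\<And>x. F (A *v x) = F x" by (auto simp: stabilizer_Upsilon)
  then obtain A' where A': "A ** A' = mat 1" "A' ** A = mat 1" by (auto simp: invertible_def)
  obtain p q where pq: "p \<bullet> p = 1" "q \<bullet> q = 1" "\<And>x. A *v x = gact p q x"
  proof (rule stabilizer_gact[of "(*v) A" "(*v) A'"])
    show "A *v (A' *v x) = x" "A' *v (A *v x) = x" for x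
      by (simp_all add: matrix_vector_mul_assoc A')
  qed (use A in auto)
  then have "A = matrix (gact p q)"
    by (simp add: matrix_eq matrix_gact_vec)
  then show "A \<in> rho ` H7" using pq by (auto simp: rho_H7)
next
  fix A assume "A \<in> rho ` H7"
  then obtain p q where A: "A = matrix (gact p q)" "p \<bullet> p = 1" "q \<bullet> q = 1" by (auto simp: rho_H7)
  have "invertible A"
    using matrix_gact_SO8[OF A(2,3)] by (auto simp: SO8_def A(1) invertible_det_nz)
  then show "A \<in> stabilizer Upsilon"
    by (simp add: stabilizer_Upsilon A(1) matrix_gact_vec F_gact A(2,3))
qed

lemma irreducible_rho_phi7: "irreducible_SU2xSU2_rep (\<lambda>g. rho (phi7 g))"
proof -
  have hom: "rho (phi7 (u ** u', v ** v')) = rho (phi7 (u, v)) ** rho (phi7 (u', v'))"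
    if "u \<in> SU2" "v \<in> SU2" "u' \<in> SU2" "v' \<in> SU2" for u v u' v'
    using that by (simp add: phi7_def rho_K7 su2_quat_mult matrix_gact_mult)
  have one: "rho (phi7 (mat 1, mat 1)) = mat 1"
    by (simp add: phi7_def su2_quat_mat rho_K7 matrix_eq matrix_gact_vec flip: su2_mat_one) (simp add: opS_qone flip: opS_gact)
  have "W = {0} \<or> W = UNIV"
    if W: "subspace W" and inv: "\<forall>g\<in>SU2 \<times> SU2. \<forall>x\<in>W. rho (phi7 g) *v x \<in> W" for W
  proof (rule irreducible_gact[OF W])
    fix p q :: "real^4" and x assume "p \<bullet> p = 1" "q \<bullet> q = 1" "x \<in> W"
    then have "rho (phi7 (su2_mat p, su2_mat q)) *v x \<in> W"
      using inv by (auto simp: SU2_eq)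
    then show "gact p q x \<in> W"
      by (simp add: phi7_def su2_quat_mat rho_K7 matrix_gact_vec)
  qed
  then show ?thesis
    by (simp add: irreducible_SU2xSU2_rep_def SU2xSU2_rep_def continuous_on_rho_phi7 one hom)
qed

theorem proposition9p3:
  shows "(\<exists>!T. symmetric_tensor T \<and> (\<forall>x. tensor_form T x = F x)) \<and>
    stabilizer Upsilon \<subseteq> SO8 \<and>
    stabilizer Upsilon = rho ` H7 \<and>
    (\<exists>\<phi>. SU2xSU2_rep \<phi> \<and>
         (\<forall>t1 t2 t3 \<tau>1 \<tau>2 \<tau>3.
            \<phi> (su2_prod t1 t2 t3, su2_prod \<tau>1 \<tau>2 \<tau>3) = h_mat t1 t2 t3 \<tau>1 \<tau>2 \<tau>3) \<and>
         \<phi> ` (SU2 \<times> SU2) = H7 \<and>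
         irreducible_SU2xSU2_rep (\<lambda>g. rho (\<phi> g)))"
proof (intro conjI exI allI)
  show "stabilizer Upsilon \<subseteq> SO8"
    unfolding stabilizer_eq rho_H7 using matrix_gact_SO8 by blast
  show "phi7 ` (SU2 \<times> SU2) = H7"
    by (simp add: phi7_image H7_eq)
qed (rule Upsilon_unique stabilizer_eq SU2xSU2_rep_phi7 phi7_su2_prod irreducible_rho_phi7)+

end
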